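(* Let $$H(U_1,\ldots,U_n):=\sum_{k=1}^\infty\sum_{|\alpha|=k}\overline{a}_\alpha U_\alpha^*+a_0I+\sum_{k=1}^\infty\sum_{|\alpha|=k}a_\alpha U_\alpha,\quad a_\alpha\in\mathbb{C},$$ be a selfadjoint element of the reduced group $C^*$-algebra $C^*_{\mathrm{red}}(\mathbb{F}_n)$ with $\|H(U_1,\ldots,U_n)\|\leq1$. Let $\mathcal{H}$ denote an arbitrary Hilbert space. Then (i) $\left(\sum_{|\alpha|=k}|a_\alpha|^2\right)^{1/2}\leq1-|a_0|$ for any $k=1,2,\ldots$; (ii) $\sum_{k=0}^\infty\left\|\sum_{|\alpha|=k}|a_\alpha|T_\alpha\right\|\leq1$ for any $(T_1,\ldots,T_n)\in[B(\mathcal{H})^n]_{1/2}$; (iii) $\sum_{k=1}^\infty\left\|\sum_{|\alpha|=k}|\overline{a}_\alpha|T_\alpha^*\right\|+|a_0|+\sum_{k=1}^\infty\left\|\sum_{|\alpha|=k}|a_\alpha|T_\alpha\right\|\leq1$ for any $(T_1,\ldots,T_n)\in[B(\mathcal{H})^n]_{1/3}$. In particular, if $r_1,\ldots,r_n\geq0$, then (iv) $\sum_{k=0}^\infty\left(\sum_{|\alpha|=k}|a_\alpha|r_\alpha\right)\leq1$ if $\|(r_1,\ldots,r_n)\|_2\leq\frac12$; (v) $|a_0|+2\sum_{k=1}^\infty\left(\sum_{|\alpha|=k}|a_\alpha|r_\alpha\right)\leq1$ if $\|(r_1,\ldots,r_n)\|_2\leq\frac13$.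
   Context: $\mathbb{F}_n$ is the free group with generators $g_1,\dots,g_n$, and $\ell^2(\mathbb{F}_n)$ has canonical basis $\{\xi_\sigma\}_{\sigma\in\mathbb{F}_n}$. The unitary operators $U_i$ on $\ell^2(\mathbb{F}_n)$ are $U_i\xi_\sigma=\xi_{g_i\sigma}$; $C^*_{\mathrm{red}}(\mathbb{F}_n)$ is the $C^*$-algebra generated by $U_1,\dots,U_n$. $\mathbb{F}_n^+\subset\mathbb{F}_n$ is the unital free semigroup on $g_1,\dots,g_n$ with identity $g_0$; $|g_{i_1}\cdots g_{i_k}|=k$, $|g_0|=0$; sums are over $\alpha\in\mathbb{F}_n^+$. The series for $H$ is understood as its Fourier expansion: $H\in C^*_{\mathrm{red}}(\mathbb{F}_n)$ is the operator with $\langle H\xi_{g_0},\xi_\alpha\rangle=a_\alpha$ for $\alpha\in\mathbb{F}_n^+$, $\langle H\xi_{g_0},\xi_{\alpha^{-1}}\rangle=\overline{a}_\alpha$ for $\alpha\in\mathbb{F}_n^+\setminus\{g_0\}$, and $\langle H\xi_{g_0},\xi_\sigma\rangle=0$ for all other $\sigma\in\mathbb{F}_n$. For $\alpha=g_{i_1}\cdots g_{i_k}$, $T_\alpha:=T_{i_1}\cdots T_{i_k}$, $T_{g_0}:=I$ (similarly for scalars), $T_\alpha^*:=(T_\alpha)^*$; $a_0:=a_{g_0}$. $[B(\mathcal{H})^n]_r:=\{(T_1,\ldots,T_n):\|T_1T_1^*+\cdots+T_nT_n^*\|^{1/2}\le r\}$. $\|\cdot\|_2$ is the Euclidean norm.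 *)

theory Defs
  imports "HOL-Analysis.Analysis"
begin

section \<open>Complex Hilbert spaces\<close>

text \<open>
  A complex inner product space is presented as a real inner product space (with
  \<open>inner x y = Re (cinner x y)\<close>, hence with the usual norm) that carries a compatible complex
  structure. The complex inner product is linear in its \<^emph>\<open>first\<close> argument.
\<close>

class complex_inner = real_inner +
  fixes scaleC :: "complex \<Rightarrow> 'a \<Rightarrow> 'a"  (infixr \<open>*\<^sub>C\<close> 75)
    and cinner :: "'a \<Rightarrow> 'a \<Rightarrow> complex"
  assumes scaleC_add_right: "c *\<^sub>C (x + y) = c *\<^sub>C x + c *\<^sub>C y"
    and scaleC_add_left: "(c + d) *\<^sub>C x = c *\<^sub>C x + d *\<^sub>C x"
    and scaleC_scaleC: "c *\<^sub>C d *\<^sub>C x = (c * d) *\<^sub>C x"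
    and scaleR_scaleC: "r *\<^sub>R x = complex_of_real r *\<^sub>C x"
    and cinner_commute: "cinner x y = cnj (cinner y x)"
    and cinner_add_left: "cinner (x + y) z = cinner x z + cinner y z"
    and cinner_scaleC_left: "cinner (c *\<^sub>C x) y = c * cinner x y"
    and inner_eq_Re_cinner: "inner x y = Re (cinner x y)"

class complex_hilbert = complex_inner + complete_space

subsection \<open>Bounded complex-linear operators\<close>

text \<open>
  The type \<open>'h \<Rightarrow>\<^sub>L 'h\<close> consists of the bounded \<^emph>\<open>real\<close>-linear operators, with the operator norm;
  \<open>B(H)\<close> is the subset of its complex-linear elements.
\<close>

definition bounded_ops :: "('h::complex_hilbert \<Rightarrow>\<^sub>L 'h) set"  (\<open>\<B>\<close>)
  where "\<B> = {S. \<forall>c x. blinfun_apply S (c *\<^sub>C x) = c *\<^sub>C blinfun_apply S x}"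

definition scale_op :: "complex \<Rightarrow> ('h::complex_hilbert \<Rightarrow>\<^sub>L 'h) \<Rightarrow> ('h \<Rightarrow>\<^sub>L 'h)"
  where "scale_op c S = Blinfun (\<lambda>x. c *\<^sub>C blinfun_apply S x)"

text \<open>Meaningful for \<open>S \<in> \<B>\<close>, where the adjoint exists by the Riesz representation theorem.\<close>

definition adj :: "('h::complex_hilbert \<Rightarrow>\<^sub>L 'h) \<Rightarrow> ('h \<Rightarrow>\<^sub>L 'h)"
  where "adj S = (THE R. R \<in> \<B> \<and>
           (\<forall>x y. cinner (blinfun_apply S x) y = cinner x (blinfun_apply R y)))"

definition cstar_subalgebra :: "('h::complex_hilbert \<Rightarrow>\<^sub>L 'h) set \<Rightarrow> bool"
  where "cstar_subalgebra A \<longleftrightarrow>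
           A \<subseteq> \<B> \<and> 0 \<in> A \<and>
           (\<forall>R\<in>A. \<forall>S\<in>A. R + S \<in> A) \<and>
           (\<forall>c. \<forall>S\<in>A. scale_op c S \<in> A) \<and>
           (\<forall>R\<in>A. \<forall>S\<in>A. R o\<^sub>L S \<in> A) \<and>
           (\<forall>S\<in>A. adj S \<in> A) \<and>
           closed A"

text \<open>The row ball \<open>[B(H)\<^sup>n]\<^sub>r\<close>; the indices \<open>1, \<dots>, n\<close> are the elements of the finite type \<open>'n\<close>.\<close>

definition row_ball :: "real \<Rightarrow> ('n::finite \<Rightarrow> ('h::complex_hilbert \<Rightarrow>\<^sub>L 'h)) set"
  where "row_ball r = {T. (\<forall>i. T i \<in> \<B>) \<and> sqrt (norm (\<Sum>i\<in>UNIV. T i o\<^sub>L adj (T i))) \<le> r}"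

definition word_op :: "('n \<Rightarrow> ('h::complex_hilbert \<Rightarrow>\<^sub>L 'h)) \<Rightarrow> 'n list \<Rightarrow> ('h \<Rightarrow>\<^sub>L 'h)"
  where "word_op T \<alpha> = foldr (\<lambda>i S. T i o\<^sub>L S) \<alpha> id_blinfun"


section \<open>The Hilbert space of square-summable families\<close>

lemma cmod_add_square_le: "(cmod (a + b))\<^sup>2 \<le> 2 * (cmod a)\<^sup>2 + 2 * (cmod b)\<^sup>2"
proof -
  have "(cmod (a + b))\<^sup>2 \<le> (cmod a + cmod b)\<^sup>2"
    by (simp add: norm_triangle_ineq power_mono)
  also have "\<dots> \<le> 2 * (cmod a)\<^sup>2 + 2 * (cmod b)\<^sup>2"
    using sum_squares_bound[of "cmod a" "cmod b"] by (simp add: power2_sum)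
  finally show ?thesis .
qed

lemma square_summable_add:
  fixes f g :: "'a \<Rightarrow> complex"
  assumes "(\<lambda>i. (cmod (f i))\<^sup>2) summable_on UNIV" "(\<lambda>i. (cmod (g i))\<^sup>2) summable_on UNIV"
  shows "(\<lambda>i. (cmod (f i + g i))\<^sup>2) summable_on UNIV"
proof (rule summable_on_comparison_test)
  show "(\<lambda>i. 2 * (cmod (f i))\<^sup>2 + 2 * (cmod (g i))\<^sup>2) summable_on UNIV"
    by (intro summable_on_add summable_on_cmult_right assms)
qed (auto intro: cmod_add_square_le)

lemma square_summable_scale:
  fixes f :: "'a \<Rightarrow> complex"
  assumes "(\<lambda>i. (cmod (f i))\<^sup>2) summable_on UNIV"
  shows "(\<lambda>i. (cmod (c * f i))\<^sup>2) summable_on UNIV"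
  unfolding norm_mult power_mult_distrib by (intro summable_on_cmult_right assms)

typedef 'a ell2 = "{f :: 'a \<Rightarrow> complex. (\<lambda>i. (cmod (f i))\<^sup>2) summable_on UNIV}"
  morphisms ell2_nth Abs_ell2
  by (rule exI[of _ "\<lambda>_. 0"]) simp

setup_lifting type_definition_ell2

lemma ell2_eqI: "(\<And>i. ell2_nth x i = ell2_nth y i) \<Longrightarrow> x = y"
  by (simp add: ell2_nth_inject[symmetric] fun_eq_iff)

lemma summable_ell2_nth: "(\<lambda>i. (cmod (ell2_nth x i))\<^sup>2) summable_on UNIV"
  using ell2_nth[of x] by simp

lemma summable_ell2_mult: "(\<lambda>i. ell2_nth x i * cnj (ell2_nth y i)) summable_on UNIV"
proof (rule abs_summable_summable, rule summable_on_comparison_test)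
  show "(\<lambda>i. (cmod (ell2_nth x i))\<^sup>2 + (cmod (ell2_nth y i))\<^sup>2) summable_on UNIV"
    by (intro summable_on_add summable_ell2_nth)
  show "norm (ell2_nth x i * cnj (ell2_nth y i)) \<le> (cmod (ell2_nth x i))\<^sup>2 + (cmod (ell2_nth y i))\<^sup>2"
    for i
  proof -
    have "0 \<le> cmod (ell2_nth x i) * cmod (ell2_nth y i)"
      by simp
    then show ?thesis
      using sum_squares_bound[of "cmod (ell2_nth x i)" "cmod (ell2_nth y i)"]
      unfolding norm_mult complex_mod_cnj by linarith
  qed
qed auto

instantiation ell2 :: (type) real_vector
begin

lift_definition zero_ell2 :: "'a ell2" is "\<lambda>_. 0"
  by simp

lift_definition plus_ell2 :: "'a ell2 \<Rightarrow> 'a ell2 \<Rightarrow> 'a ell2" is "\<lambda>f g i. f i + g i"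
  by (rule square_summable_add)

lift_definition uminus_ell2 :: "'a ell2 \<Rightarrow> 'a ell2" is "\<lambda>f i. - f i"
  by simp

lift_definition minus_ell2 :: "'a ell2 \<Rightarrow> 'a ell2 \<Rightarrow> 'a ell2" is "\<lambda>f g i. f i - g i"
  using square_summable_add[of _ "\<lambda>i. - _ i"] by simp

lift_definition scaleR_ell2 :: "real \<Rightarrow> 'a ell2 \<Rightarrow> 'a ell2" is "\<lambda>r f i. complex_of_real r * f i"
  by (rule square_summable_scale)

instance
  by intro_classes (transfer; simp add: fun_eq_iff algebra_simps)+

end

instantiation ell2 :: (type) complex_inner
begin

lift_definition scaleC_ell2 :: "complex \<Rightarrow> 'a ell2 \<Rightarrow> 'a ell2" is "\<lambda>c f i. c * f i"
  by (rule square_summable_scale)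

definition cinner_ell2 :: "'a ell2 \<Rightarrow> 'a ell2 \<Rightarrow> complex"
  where "cinner_ell2 x y = (\<Sum>\<^sub>\<infinity>i. ell2_nth x i * cnj (ell2_nth y i))"

definition inner_ell2 :: "'a ell2 \<Rightarrow> 'a ell2 \<Rightarrow> real"
  where "inner_ell2 x y = Re (cinner x y)"

definition norm_ell2 :: "'a ell2 \<Rightarrow> real"
  where "norm_ell2 x = sqrt (inner x x)"

definition dist_ell2 :: "'a ell2 \<Rightarrow> 'a ell2 \<Rightarrow> real"
  where "dist_ell2 x y = norm (x - y)"

definition sgn_ell2 :: "'a ell2 \<Rightarrow> 'a ell2"
  where "sgn_ell2 x = x /\<^sub>R norm x"

definition uniformity_ell2 :: "('a ell2 \<times> 'a ell2) filter"
  where "uniformity_ell2 = (INF e\<in>{0<..}. principal {(x, y). dist x y < e})"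

definition open_ell2 :: "'a ell2 set \<Rightarrow> bool"
  where "open_ell2 S \<longleftrightarrow> (\<forall>x\<in>S. \<forall>\<^sub>F (x', y) in uniformity. x' = x \<longrightarrow> y \<in> S)"

lemma inner_ell2_self: "inner x x = (\<Sum>\<^sub>\<infinity>i. (cmod (ell2_nth x i))\<^sup>2)"
  unfolding inner_ell2_def cinner_ell2_def
  by (simp only: infsum_Re[OF summable_ell2_mult, symmetric]) (simp add: cmod_power2 flip: power2_eq_square)

instance
proof
  fix x y z :: "'a ell2" and c d :: complex and r :: real
  show comm: "cinner x y = cnj (cinner y x)" for x y :: "'a ell2"
    unfolding cinner_ell2_def infsum_cnj[symmetric] by (simp add: mult.commute)
  show add: "cinner (x + y) z = cinner x z + cinner y z"
    unfolding cinner_ell2_def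
    by (simp add: plus_ell2.rep_eq distrib_right infsum_add summable_ell2_mult)
  show scale: "cinner (c *\<^sub>C x) y = c * cinner x y" for c
    unfolding cinner_ell2_def
    by (simp add: scaleC_ell2.rep_eq mult.assoc infsum_cmult_right summable_ell2_mult)
  show scaleR: "r *\<^sub>R x = complex_of_real r *\<^sub>C x"
    by (rule ell2_eqI) (simp add: scaleR_ell2.rep_eq scaleC_ell2.rep_eq)
  show "inner x y = inner y x"
    unfolding inner_ell2_def by (subst comm) simp
  show "inner (x + y) z = inner x z + inner y z"
    by (simp add: inner_ell2_def add)
  show "inner (r *\<^sub>R x) y = r * inner x y"
    by (simp add: inner_ell2_def scaleR scale)
  show "0 \<le> inner x x"
    by (simp add: inner_ell2_self infsum_nonneg)
  show "inner x x = 0 \<longleftrightarrow> x = 0"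
  proof
    assume "inner x x = 0"
    then have "(cmod (ell2_nth x i))\<^sup>2 = 0" for i
      unfolding inner_ell2_self by (intro nonneg_infsum_le_0D[OF _ summable_ell2_nth]) auto
    then show "x = 0"
      by (intro ell2_eqI) (simp add: zero_ell2.rep_eq)
  qed (simp add: inner_ell2_self zero_ell2.rep_eq)
  show "c *\<^sub>C (x + y) = c *\<^sub>C x + c *\<^sub>C y" "(c + d) *\<^sub>C x = c *\<^sub>C x + d *\<^sub>C x"
    "c *\<^sub>C d *\<^sub>C x = (c * d) *\<^sub>C x"
    by (transfer; simp add: fun_eq_iff algebra_simps)+
qed (fact dist_ell2_def sgn_ell2_def uniformity_ell2_def open_ell2_def norm_ell2_def inner_ell2_def)+

end

lemma norm_ell2_square: "(norm x)\<^sup>2 = (\<Sum>\<^sub>\<infinity>i. (cmod (ell2_nth x i))\<^sup>2)"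
  by (simp add: norm_ell2_def inner_ell2_self infsum_nonneg)

lemma finite_sum_le_norm_ell2:
  "finite F \<Longrightarrow> (\<Sum>i\<in>F. (cmod (ell2_nth x i))\<^sup>2) \<le> (norm x)\<^sup>2"
  unfolding norm_ell2_square by (intro finite_sum_le_infsum summable_ell2_nth) auto

lemma cmod_ell2_nth_le: "cmod (ell2_nth x i) \<le> norm x"
  using finite_sum_le_norm_ell2[of "{i}" x] by (simp add: abs_le_square_iff[symmetric])

instance ell2 :: (type) complex_hilbert
proof
  fix X :: "nat \<Rightarrow> 'a ell2"
  assume X: "Cauchy X"
  have "Cauchy (\<lambda>n. ell2_nth (X n) i)" for i
  proof (rule metric_CauchyI)
    fix e :: real assume "0 < e"
    then obtain N where N: "\<forall>m\<ge>N. \<forall>n\<ge>N. dist (X m) (X n) < e"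
      using X by (meson metric_CauchyD)
    have "dist (ell2_nth (X m) i) (ell2_nth (X n) i) \<le> dist (X m) (X n)" for m n
      using cmod_ell2_nth_le[of "X m - X n" i] by (simp add: dist_norm minus_ell2.rep_eq)
    then show "\<exists>N. \<forall>m\<ge>N. \<forall>n\<ge>N. dist (ell2_nth (X m) i) (ell2_nth (X n) i) < e"
      using N by (meson le_less_trans)
  qed
  then have "\<forall>i. \<exists>l. (\<lambda>n. ell2_nth (X n) i) \<longlonglongrightarrow> l"
    by (simp add: Cauchy_convergent_iff convergent_def)
  then obtain f where f: "\<And>i. (\<lambda>n. ell2_nth (X n) i) \<longlonglongrightarrow> f i"
    by metis
  have bound: "(\<Sum>i\<in>F. (cmod (ell2_nth (X m) i - f i))\<^sup>2) \<le> e\<^sup>2"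
    if "finite F" and N: "\<And>n. n \<ge> N \<Longrightarrow> dist (X m) (X n) < e" for F m N and e :: real
  proof (rule tendsto_upperbound)
    show "(\<lambda>n. \<Sum>i\<in>F. (cmod (ell2_nth (X m) i - ell2_nth (X n) i))\<^sup>2)
            \<longlonglongrightarrow> (\<Sum>i\<in>F. (cmod (ell2_nth (X m) i - f i))\<^sup>2)"
      by (intro tendsto_intros f)
    have "(\<Sum>i\<in>F. (cmod (ell2_nth (X m) i - ell2_nth (X n) i))\<^sup>2) \<le> e\<^sup>2" if "n \<ge> N" for n
    proof -
      have "(\<Sum>i\<in>F. (cmod (ell2_nth (X m) i - ell2_nth (X n) i))\<^sup>2) \<le> (norm (X m - X n))\<^sup>2"
        using finite_sum_le_norm_ell2[OF \<open>finite F\<close>, of "X m - X n"]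
        by (simp add: minus_ell2.rep_eq)
      also have "\<dots> \<le> e\<^sup>2"
        using N[OF that] by (intro power_mono) (auto simp: dist_norm)
      finally show ?thesis .
    qed
    then show "\<forall>\<^sub>F n in sequentially. (\<Sum>i\<in>F. (cmod (ell2_nth (X m) i - ell2_nth (X n) i))\<^sup>2) \<le> e\<^sup>2"
      by (auto simp: eventually_sequentially)
  qed simp
  have diff_summable: "(\<lambda>i. (cmod (ell2_nth (X m) i - f i))\<^sup>2) summable_on UNIV"
    if "\<And>n. n \<ge> N \<Longrightarrow> dist (X m) (X n) < e" for m N and e :: real
    using bound[OF _ that] by (intro nonneg_bounded_partial_sums_imp_summable_on)
      (auto intro!: eventually_finite_subsets_at_top_weakI)
  obtain N1 where N1: "\<And>m n. m \<ge> N1 \<Longrightarrow> n \<ge> N1 \<Longrightarrow> dist (X m) (X n) < 1"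
    using X by (meson metric_CauchyD zero_less_one)
  have "(\<lambda>i. (cmod (ell2_nth (X N1) i + (-1) * (ell2_nth (X N1) i - f i)))\<^sup>2) summable_on UNIV"
    by (intro square_summable_add square_summable_scale summable_ell2_nth diff_summable[of N1])
      (auto intro: N1)
  then have "(\<lambda>i. (cmod (f i))\<^sup>2) summable_on UNIV"
    by simp
  then have L: "ell2_nth (Abs_ell2 f) = f"
    by (simp add: Abs_ell2_inverse)
  have "X \<longlonglongrightarrow> Abs_ell2 f"
  proof (rule metric_LIMSEQ_I)
    fix e :: real assume "0 < e"
    then obtain N where N: "\<And>m n. m \<ge> N \<Longrightarrow> n \<ge> N \<Longrightarrow> dist (X m) (X n) < e / 2"
      using X by (meson metric_CauchyD half_gt_zero)
    have "dist (X m) (Abs_ell2 f) < e" if "m \<ge> N" for m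
    proof -
      have "(norm (X m - Abs_ell2 f))\<^sup>2 = (\<Sum>\<^sub>\<infinity>i. (cmod (ell2_nth (X m) i - f i))\<^sup>2)"
        by (simp add: norm_ell2_square minus_ell2.rep_eq L)
      also have "\<dots> \<le> (e / 2)\<^sup>2"
        using N[OF that] by (intro infsum_le_finite_sums diff_summable[of N] bound[of _ N])
      finally have "norm (X m - Abs_ell2 f) \<le> e / 2"
        using \<open>0 < e\<close> by (simp add: abs_le_square_iff[symmetric])
      then show ?thesis
        using \<open>0 < e\<close> by (simp add: dist_norm)
    qed
    then show "\<exists>N. \<forall>m\<ge>N. dist (X m) (Abs_ell2 f) < e"
      by blast
  qed
  then show "convergent X"
    by (auto simp: convergent_def)
qed

lift_definition ell2_basis :: "'a \<Rightarrow> 'a ell2"  (\<open>\<xi>\<close>)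
  is "\<lambda>\<sigma> \<tau>. if \<tau> = \<sigma> then 1 else 0"
proof -
  fix \<sigma> :: 'a
  have "(\<lambda>\<tau>. (cmod (if \<tau> = \<sigma> then 1 else 0))\<^sup>2) summable_on {\<sigma>}"
    by simp
  then show "(\<lambda>\<tau>. (cmod (if \<tau> = \<sigma> then 1 else 0))\<^sup>2) summable_on UNIV"
    by (rule summable_on_cong_neutral[THEN iffD1, rotated -1]) auto
qed


section \<open>The free group\<close>

text \<open>
  Letters are pairs \<open>(i, b)\<close>: \<open>(i, True)\<close> is the generator \<open>g\<^sub>i\<close> and \<open>(i, False)\<close> its inverse.
  The free group on the set of generators \<open>'n\<close> consists of the words modulo cancellation.
\<close>

inductive cancel_step :: "('n \<times> bool) list \<Rightarrow> ('n \<times> bool) list \<Rightarrow> bool"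
  where "cancel_step (u @ [(i, b), (i, \<not> b)] @ v) (u @ v)"

abbreviation word_equiv :: "('n \<times> bool) list \<Rightarrow> ('n \<times> bool) list \<Rightarrow> bool"
  where "word_equiv \<equiv> equivclp cancel_step"

definition inv_word :: "('n \<times> bool) list \<Rightarrow> ('n \<times> bool) list"
  where "inv_word w = rev (map (\<lambda>(i, b). (i, \<not> b)) w)"

lemma word_equiv_map:
  assumes "\<And>u v. cancel_step u v \<Longrightarrow> cancel_step (h u) (h v)" and "word_equiv u v"
  shows "word_equiv (h u) (h v)"
  using assms(2)
proof (induction rule: equivclp_induct)
  case (step y z)
  then have "word_equiv (h y) (h z)"
    using assms(1) by (blast intro: r_into_equivclp equivclp_sym)
  with step show ?case
    by (blast intro: equivclp_trans)
qed simp

lemma cancel_step_append_left: "cancel_step u v \<Longrightarrow> cancel_step (w @ u) (w @ v)"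
  by (metis append_assoc cancel_step.simps)

lemma cancel_step_append_right: "cancel_step u v \<Longrightarrow> cancel_step (u @ w) (v @ w)"
  by (metis append_assoc cancel_step.simps)

lemma cancel_step_inv_word: "cancel_step u v \<Longrightarrow> cancel_step (inv_word u) (inv_word v)"
proof (induction rule: cancel_step.induct)
  case (1 u i b v)
  show ?case
    using cancel_step.intros[of "inv_word v" i b "inv_word u"] by (simp add: inv_word_def)
qed

lemma word_equiv_append:
  assumes "word_equiv u u'" "word_equiv v v'"
  shows "word_equiv (u @ v) (u' @ v')"
  using word_equiv_map[of "\<lambda>w. w @ v", OF cancel_step_append_right assms(1)]
    word_equiv_map[of "\<lambda>w. u' @ w", OF cancel_step_append_left assms(2)]
  by (blast intro: equivclp_trans)

lemma word_equiv_inv_word_append: "word_equiv (inv_word w @ w) []"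
proof (induction w)
  case (Cons a w)
  obtain i b where a: "a = (i, b)"
    by fastforce
  have "cancel_step (inv_word (a # w) @ a # w) (inv_word w @ w)"
    using cancel_step.intros[of "inv_word w" i "\<not> b" w] by (simp add: a inv_word_def)
  then show ?case
    using Cons.IH by (blast intro: r_into_equivclp equivclp_trans)
qed (simp add: inv_word_def)

quotient_type 'n free_group = "('n \<times> bool) list" / word_equiv
  by (rule equivp_evquivclp)

instantiation free_group :: (type) "{monoid_mult, inverse}"
begin

lift_definition one_free_group :: "'n free_group" is "[]" .

lift_definition times_free_group :: "'n free_group \<Rightarrow> 'n free_group \<Rightarrow> 'n free_group" is "(@)"
  by (rule word_equiv_append)

lift_definition inverse_free_group :: "'n free_group \<Rightarrow> 'n free_group" is inv_word
  by (rule word_equiv_map[OF cancel_step_inv_word])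

definition divide_free_group :: "'n free_group \<Rightarrow> 'n free_group \<Rightarrow> 'n free_group"
  where "divide_free_group \<sigma> \<tau> = \<sigma> * inverse \<tau>"

instance
proof
  fix \<rho> \<sigma> \<tau> :: "'n free_group"
  show "\<rho> * \<sigma> * \<tau> = \<rho> * (\<sigma> * \<tau>)" "1 * \<sigma> = \<sigma>" "\<sigma> * 1 = \<sigma>"
    by (transfer; simp)+
qed

end

lemma free_group_left_inverse: "inverse \<sigma> * \<sigma> = (1 :: 'n free_group)"
  by transfer (rule word_equiv_inv_word_append)

lemma free_group_inverse_cancel [simp]: "inverse \<sigma> * (\<sigma> * \<tau>) = (\<tau> :: 'n free_group)"
  by (simp add: mult.assoc[symmetric] free_group_left_inverse)

lemma free_group_right_inverse: "\<sigma> * inverse \<sigma> = (1 :: 'n free_group)"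
  by (metis free_group_inverse_cancel mult.right_neutral free_group_left_inverse)

lemma free_group_inverse_cancel' [simp]: "\<sigma> * (inverse \<sigma> * \<tau>) = (\<tau> :: 'n free_group)"
  by (simp add: mult.assoc[symmetric] free_group_right_inverse)

lift_definition gen :: "'n \<Rightarrow> 'n free_group" is "\<lambda>i. [(i, True)]" .

lifting_forget free_group.lifting

text \<open>
  The free semigroup \<open>F\<^sub>n\<^sup>+\<close> is rendered as the type \<open>'n list\<close>, so \<open>|\<alpha>|\<close> is \<open>length \<alpha>\<close> and
  \<open>g\<^sub>0\<close> is \<open>[]\<close>; the following map is its embedding into the free group.
\<close>

definition pos :: "'n list \<Rightarrow> 'n free_group"
  where "pos \<alpha> = prod_list (map gen \<alpha>)"


section \<open>The reduced group C*-algebra of the free group\<close>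

lemma bij_mult_left: "bij ((*) (\<sigma> :: 'n free_group))"
  by (rule bij_betw_byWitness[where f' = "(*) (inverse \<sigma>)"]) auto

lift_definition translate :: "'n free_group \<Rightarrow> 'n free_group ell2 \<Rightarrow> 'n free_group ell2"
  is "\<lambda>\<sigma> f \<tau>. f (inverse \<sigma> * \<tau>)"
  by (simp add: summable_on_reindex_bij_betw[OF bij_mult_left, of "\<lambda>i. (cmod (_ i))\<^sup>2"])

lemma norm_translate: "norm (translate \<sigma> x) = norm x"
proof -
  have "(norm (translate \<sigma> x))\<^sup>2 = (norm x)\<^sup>2"
    unfolding norm_ell2_square translate.rep_eq
    by (rule infsum_reindex_bij_betw[OF bij_mult_left])
  then show ?thesis
    by simp
qed

text \<open>\<open>U i\<close> is left translation by \<open>g\<^sub>i\<close>, i.e. \<open>U\<^sub>i \<xi>\<^sub>\<sigma> = \<xi>\<^bsub>g\<^sub>i\<sigma>\<^esub>\<close>, see \<open>U_basis\<close>.\<close>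

lift_definition U :: "'n \<Rightarrow> ('n free_group ell2 \<Rightarrow>\<^sub>L 'n free_group ell2)" is "\<lambda>i. translate (gen i)"
proof (rule bounded_linear_intro[where K = 1])
  fix i :: 'n and x y :: "'n free_group ell2" and r :: real
  show "translate (gen i) (x + y) = translate (gen i) x + translate (gen i) y"
    "translate (gen i) (r *\<^sub>R x) = r *\<^sub>R translate (gen i) x"
    by (transfer; simp)+
qed (simp add: norm_translate)

lemma U_basis: "blinfun_apply (U i) (\<xi> \<sigma>) = \<xi> (gen i * \<sigma>)"
proof (rule ell2_eqI)
  fix \<tau>
  have "inverse (gen i) * \<tau> = \<sigma> \<longleftrightarrow> \<tau> = gen i * \<sigma>"
    by auto
  then show "ell2_nth (blinfun_apply (U i) (\<xi> \<sigma>)) \<tau> = ell2_nth (\<xi> (gen i * \<sigma>)) \<tau>"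
    by (simp add: U.rep_eq translate.rep_eq ell2_basis.rep_eq)
qed

lemma U_bounded_op: "U i \<in> \<B>"
  by (auto simp: bounded_ops_def U.rep_eq translate.rep_eq scaleC_ell2.rep_eq intro: ell2_eqI)

definition reduced_cstar :: "('n free_group ell2 \<Rightarrow>\<^sub>L 'n free_group ell2) set"
  where "reduced_cstar = cstar_subalgebra hull range U"

text \<open>
  \<open>H\<close> has the Fourier expansion
  \<open>\<Sum>\<^bsub>|\<alpha>| \<ge> 1\<^esub> cnj a\<^sub>\<alpha> U\<^sub>\<alpha>\<^sup>* + a\<^sub>0 I + \<Sum>\<^bsub>|\<alpha>| \<ge> 1\<^esub> a\<^sub>\<alpha> U\<^sub>\<alpha>\<close>.
\<close>

definition has_fourier_expansion ::
    "('n free_group ell2 \<Rightarrow>\<^sub>L 'n free_group ell2) \<Rightarrow> ('n list \<Rightarrow> complex) \<Rightarrow> bool"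
  where "has_fourier_expansion H a \<longleftrightarrow>
    (\<forall>\<alpha>. cinner (blinfun_apply H (\<xi> 1)) (\<xi> (pos \<alpha>)) = a \<alpha>) \<and>
    (\<forall>\<alpha>. \<alpha> \<noteq> [] \<longrightarrow> cinner (blinfun_apply H (\<xi> 1)) (\<xi> (inverse (pos \<alpha>))) = cnj (a \<alpha>)) \<and>
    (\<forall>\<sigma>. \<sigma> \<notin> range pos \<union> inverse ` range pos \<longrightarrow>
          cinner (blinfun_apply H (\<xi> 1)) (\<xi> \<sigma>) = 0)"

end

theory Submission
  imports Defs
begin

text \<open>
  Operators in the reduced group algebra commute with right translations, so
  \<open>\<langle>H\<xi>\<^sub>\<sigma>, \<xi>\<^sub>\<tau>\<rangle>\<close> depends only on \<open>\<tau>\<sigma>\<^sup>-\<^sup>1\<close>. For words \<open>\<alpha> \<noteq> \<beta>\<close> of equal length \<open>\<beta>\<alpha>\<^sup>-\<^sup>1\<close> is neither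
  positive nor the inverse of a positive word, hence \<open>\<langle>H\<xi>\<^sub>\<alpha>, \<xi>\<^sub>\<beta>\<rangle> = 0\<close>. Thus on the span of \<open>\<xi>\<^sub>1\<close> and
  the unit vector along \<open>\<Sum>\<^bsub>|\<alpha>| = k\<^esub> a\<^sub>\<alpha> \<xi>\<^sub>\<alpha>\<close> the compression of \<open>H\<close> is the matrix with diagonal
  entries \<open>a\<^sub>0\<close> and off-diagonal entries \<open>s = (\<Sum>\<^bsub>|\<alpha>| = k\<^esub> |a\<^sub>\<alpha>|\<^sup>2)\<^sup>1\<^sup>/\<^sup>2\<close>; its norm is \<open>|a\<^sub>0| + s \<le> 1\<close>.
  The Bohr inequalities follow by Cauchy-Schwarz, since words of length \<open>k\<close> in a row operator of
  norm at most \<open>r\<close> form a row operator of norm at most \<open>r\<^sup>k\<close>, and by summing geometric series.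
\<close>

section \<open>Riesz representation and Hilbert space adjoints\<close>

section \<open>Adjoints\<close>

text \<open>The real version suffices, since complex linearity of an operator recovers the complex
  pairing from its real part. A minimizing sequence of a strictly convex quadratic functional is
  Cauchy, and the vanishing first variation at its limit forces the limit to represent
  \<open>f\<close>.\<close>

lemma riesz_representation:
  fixes f :: "'a::{real_inner, complete_space} \<Rightarrow> real"
  assumes "bounded_linear f"
  shows "\<exists>z. \<forall>x. f x = inner x z"
proof -
  interpret f: bounded_linear f by fact
  \<comment> \<open>The representing vector is the minimizer of this functional.\<close>
  define \<phi> where "\<phi> x = (norm x)\<^sup>2 - 2 * f x" for x
  obtain K where K: "\<And>x. norm (f x) \<le> norm x * K"
    using f.bounded by blast
  have lower: "- K\<^sup>2 \<le> \<phi> x" for x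
    using K[of x] zero_le_power2[of "norm x - K"] by (simp add: \<phi>_def power2_diff)
  define m where "m = Inf (range \<phi>)"
  have bdd: "bdd_below (range \<phi>)"
    using lower by (rule bdd_belowI2)
  have m_le: "m \<le> \<phi> x" for x
    unfolding m_def using bdd by (auto intro: cInf_lower)
  have "\<exists>x. \<phi> x < m + inverse (real (Suc n))" for n
  proof -
    have "Inf (range \<phi>) < m + inverse (real (Suc n))"
      by (simp add: m_def)
    then show ?thesis
      using cInf_lessD[of "range \<phi>"] by blast
  qed
  then obtain X where X: "\<And>n. \<phi> (X n) < m + inverse (real (Suc n))"
    by metis
  \<comment> \<open>The linear parts cancel, leaving the parallelogram law for the norm. As the
    midpoint has value at least \<open>m\<close>, two near-minimizers must be close to each
    other.\<close>
  have parallelogram: "(norm (x - y))\<^sup>2 = 2 * \<phi> x + 2 * \<phi> y - 4 * \<phi> ((x + y) /\<^sub>R 2)" for x y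
    by (simp add: \<phi>_def f.add f.scaleR power2_norm_eq_inner inner_simps inner_commute field_simps)
  have "Cauchy X"
  proof (rule metric_CauchyI)
    fix e :: real assume "0 < e"
    then obtain N where N: "inverse (real (Suc N)) < e\<^sup>2 / 4"
      using reals_Archimedean[of "e\<^sup>2 / 4"] by auto
    have "dist (X i) (X j) < e" if "N \<le> i" "N \<le> j" for i j
    proof -
      have near: "\<phi> (X k) < m + e\<^sup>2 / 4" if "N \<le> k" for k
      proof -
        have "inverse (real (Suc k)) \<le> inverse (real (Suc N))"
          using that by (intro le_imp_inverse_le) auto
        then show ?thesis
          using X[of k] N by linarith
      qed
      have "(norm (X i - X j))\<^sup>2 < e\<^sup>2"
        using parallelogram[of "X i" "X j"] m_le[of "(X i + X j) /\<^sub>R 2"]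
          near[OF that(1)] near[OF that(2)] by linarith
      then show ?thesis
        using \<open>0 < e\<close> by (simp add: dist_norm power_less_imp_less_base)
    qed
    then show "\<exists>N. \<forall>i\<ge>N. \<forall>j\<ge>N. dist (X i) (X j) < e"
      by blast
  qed
  then obtain z where z: "X \<longlonglongrightarrow> z"
    using Cauchy_convergent convergent_def by blast
  have "(\<lambda>n. \<phi> (X n)) \<longlonglongrightarrow> \<phi> z"
    unfolding \<phi>_def by (intro tendsto_intros z f.tendsto)
  moreover have "(\<lambda>n. m + inverse (real (Suc n))) \<longlonglongrightarrow> m + 0"
    by (intro tendsto_intros LIMSEQ_inverse_real_of_nat)
  ultimately have "\<phi> z \<le> m + 0"
    using X by (intro LIMSEQ_le[of _ _ "\<lambda>n. m + inverse (real (Suc n))"]) (auto intro: less_imp_le)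
  then have min: "\<phi> z \<le> \<phi> x" for x
    using m_le[of x] by simp
  have "f x = inner x z" for x
  proof (rule ccontr)
    assume "f x \<noteq> inner x z"
    define d where "d = inner x z - f x"
    define N where "N = (norm x)\<^sup>2"
    have "d \<noteq> 0" "0 \<le> N"
      using \<open>f x \<noteq> inner x z\<close> by (auto simp: d_def N_def)
    have expand: "\<phi> (z + t *\<^sub>R x) = \<phi> z + 2 * t * d + t\<^sup>2 * N" for t
      by (simp add: \<phi>_def d_def N_def f.add f.scaleR power2_norm_eq_inner inner_simps
          inner_commute)
        (simp add: power2_eq_square algebra_simps)
    \<comment> \<open>Moving from \<open>z\<close> by \<open>- p\<close> along \<open>x\<close>
      changes \<open>\<phi>\<close> by \<open>- p\<^sup>2 * (N + 2)\<close>, contradicting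
      minimality; dividing by \<open>N + 1\<close> instead of \<open>N\<close> avoids a zero
      denominator.\<close>
    define p where "p = d / (N + 1)"
    have p: "d = p * (N + 1)" "p \<noteq> 0"
      using \<open>d \<noteq> 0\<close> \<open>0 \<le> N\<close> by (simp_all add: p_def)
    have "0 \<le> 2 * (- p) * d + (- p)\<^sup>2 * N"
      using min[of "z + (- p) *\<^sub>R x"] unfolding expand by simp
    also have "\<dots> = - (p\<^sup>2 * (N + 2))"
      by (simp add: p(1) power2_eq_square algebra_simps)
    finally have "p\<^sup>2 * (N + 2) \<le> 0"
      by simp
    moreover have "0 < p\<^sup>2 * (N + 2)"
      using \<open>p \<noteq> 0\<close> \<open>0 \<le> N\<close> by simp
    ultimately show False
      by simp
  qed
  then show ?thesis
    by blast
qed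

lemma cinner_add_right: "cinner x (y + z) = cinner x y + cinner x z"
  by (metis cinner_add_left cinner_commute complex_cnj_add)

lemma cinner_scaleC_right: "cinner x (c *\<^sub>C y) = cnj c * cinner x y"
  by (metis cinner_commute cinner_scaleC_left complex_cnj_mult)

lemma cinner_zero_left [simp]: "cinner 0 x = 0"
  using cinner_add_left[of 0 0 x] by simp

lemma cinner_zero_right [simp]: "cinner x 0 = 0"
  using cinner_add_right[of x 0 0] by simp

lemma cinner_sum_left: "cinner (\<Sum>i\<in>I. f i) x = (\<Sum>i\<in>I. cinner (f i) x)"
  by (induction I rule: infinite_finite_induct) (simp_all add: cinner_add_left)

lemma cinner_sum_right: "cinner x (\<Sum>i\<in>I. f i) = (\<Sum>i\<in>I. cinner x (f i))"
  by (induction I rule: infinite_finite_induct) (simp_all add: cinner_add_right)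

text \<open>Lets an identity for the real \<open>inner\<close> be lifted to \<open>cinner\<close>
  along a complex-linear map.\<close>

lemma Im_cinner: "Im (cinner x y) = inner (- \<i> *\<^sub>C x) y"
  by (simp add: inner_eq_Re_cinner cinner_scaleC_left)

lemma cinner_eqI:
  assumes "\<And>x. cinner x y = cinner x z"
  shows "y = z"
proof -
  have "inner x y = inner x z" for x
    by (simp add: inner_eq_Re_cinner assms)
  then have "inner (y - z) (y - z) = 0"
    by (simp add: inner_diff_right)
  then show ?thesis
    by simp
qed

lemma cinner_eq_norm: "cinner x x = complex_of_real ((norm x)\<^sup>2)"
proof (rule complex_eqI)
  show "Im (cinner x x) = Im (complex_of_real ((norm x)\<^sup>2))"
    using arg_cong[OF cinner_commute[of x x], of Im] by simp
qed (simp add: power2_norm_eq_inner inner_eq_Re_cinner)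

lemma norm_scaleC: "norm (c *\<^sub>C x) = cmod c * norm x"
proof -
  have "complex_of_real ((norm (c *\<^sub>C x))\<^sup>2) = complex_of_real ((cmod c * norm x)\<^sup>2)"
    unfolding cinner_eq_norm[symmetric] cinner_scaleC_left cinner_scaleC_right
    by (simp add: cinner_eq_norm power_mult_distrib complex_norm_square del: of_real_power)
  then show ?thesis
    by (simp only: of_real_eq_iff) (simp add: power2_eq_imp_eq)
qed

lemma scaleC_zero_right [simp]: "c *\<^sub>C 0 = 0"
  using scaleC_add_right[of c 0 0] by simp

lemma bounded_linear_scaleC: "bounded_linear ((*\<^sub>C) c)"
  by (rule bounded_linear_intro[where K = "cmod c"])
    (simp_all add: scaleC_add_right scaleR_scaleC scaleC_scaleC norm_scaleC mult.commute)

lemma scale_op_apply: "blinfun_apply (scale_op c S) x = c *\<^sub>C blinfun_apply S x"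
  unfolding scale_op_def
  by (rule bounded_linear_Blinfun_apply[THEN fun_cong])
    (rule bounded_linear_compose[OF bounded_linear_scaleC blinfun.bounded_linear_right])

lemma bounded_opsD: "S \<in> \<B> \<Longrightarrow> blinfun_apply S (c *\<^sub>C x) = c *\<^sub>C blinfun_apply S x"
  by (simp add: bounded_ops_def)

text \<open>For each \<open>y\<close>, Riesz applied to the real functional pairing
  \<open>S x\<close> with \<open>y\<close> yields \<open>R y\<close>. Complex linearity of
  \<open>S\<close> extends the identity to \<open>cinner\<close>, and nondegeneracy then makes
  \<open>R\<close> complex-linear.\<close>

lemma adjoint_exists:
  assumes "S \<in> \<B>"
  shows "\<exists>R\<in>\<B>. \<forall>x y. cinner (blinfun_apply S x) y = cinner x (blinfun_apply R y)"
proof -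
  have "\<exists>z. \<forall>x. inner (blinfun_apply S x) y = inner x z" for y
    by (rule riesz_representation)
      (rule bounded_linear_compose[OF bounded_linear_inner_left blinfun.bounded_linear_right])
  then obtain R where R: "\<And>x y. inner (blinfun_apply S x) y = inner x (R y)"
    by metis
  have cR: "cinner (blinfun_apply S x) y = cinner x (R y)" for x y
  proof (rule complex_eqI)
    show "Im (cinner (blinfun_apply S x) y) = Im (cinner x (R y))"
      by (simp add: Im_cinner R[symmetric] bounded_opsD[OF assms])
  qed (simp add: R inner_eq_Re_cinner[symmetric])
  have scale: "R (c *\<^sub>C y) = c *\<^sub>C R y" for c y
    by (rule cinner_eqI) (simp add: cR[symmetric] cinner_scaleC_right)
  have "bounded_linear R"
  proof (rule bounded_linear_intro[where K = "norm S"])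
    show "R (x + y) = R x + R y" for x y
      by (rule cinner_eqI) (simp add: cR[symmetric] cinner_add_right)
    show "R (r *\<^sub>R x) = r *\<^sub>R R x" for r x
      by (simp add: scaleR_scaleC scale)
    \<comment> \<open>Testing \<open>R y\<close> against itself turns its squared norm into the
      inner product of \<open>S (R y)\<close> with \<open>y\<close>; one factor
      \<open>norm (R y)\<close> is then divided out.\<close>
    show "norm (R y) \<le> norm y * norm S" for y
    proof (cases "R y = 0")
      case False
      have "norm (R y) * norm (R y) = inner (blinfun_apply S (R y)) y"
        by (simp add: R power2_norm_eq_inner flip: power2_eq_square)
      also have "\<dots> \<le> norm (blinfun_apply S (R y)) * norm y"
        by (rule norm_cauchy_schwarz)
      also have "\<dots> \<le> (norm S * norm (R y)) * norm y"
        by (intro mult_right_mono norm_blinfun) simp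
      finally show ?thesis
        using False by (simp add: mult.commute mult.left_commute)
    qed simp
  qed
  then show ?thesis
    by (intro bexI[of _ "Blinfun R"])
      (simp_all add: bounded_ops_def bounded_linear_Blinfun_apply scale cR)
qed

text \<open>As \<open>adj\<close> is a definite description, its properties become available only
  after uniqueness, which is nondegeneracy of \<open>cinner\<close>.\<close>

lemma
  assumes "S \<in> \<B>"
  shows adj_bounded_op: "adj S \<in> \<B>"
    and cinner_adj: "cinner (blinfun_apply S x) y = cinner x (blinfun_apply (adj S) y)"
proof -
  have "\<exists>!R. R \<in> \<B> \<and> (\<forall>x y. cinner (blinfun_apply S x) y = cinner x (blinfun_apply R y))"
  proof (rule ex_ex1I)
    show "R = R'" if "R \<in> \<B> \<and> (\<forall>x y. cinner (blinfun_apply S x) y = cinner x (blinfun_apply R y))"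
      "R' \<in> \<B> \<and> (\<forall>x y. cinner (blinfun_apply S x) y = cinner x (blinfun_apply R' y))" for R R'
      using that by (intro blinfun_eqI cinner_eqI) metis
  qed (use adjoint_exists[OF assms] in blast)
  from theI'[OF this, folded adj_def] show "adj S \<in> \<B>"
    "cinner (blinfun_apply S x) y = cinner x (blinfun_apply (adj S) y)"
    by blast+
qed

lemma inner_adj: "S \<in> \<B> \<Longrightarrow> inner (blinfun_apply S x) y = inner x (blinfun_apply (adj S) y)"
  by (simp add: inner_eq_Re_cinner cinner_adj)

lemma bounded_ops_comp: "R \<in> \<B> \<Longrightarrow> S \<in> \<B> \<Longrightarrow> R o\<^sub>L S \<in> \<B>"
  by (simp add: bounded_ops_def)

lemma adj_comp_apply:
  assumes "R \<in> \<B>" "S \<in> \<B>"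
  shows "blinfun_apply (adj (R o\<^sub>L S)) x = blinfun_apply (adj S) (blinfun_apply (adj R) x)"
proof (rule cinner_eqI)
  fix w
  have "cinner w (blinfun_apply (adj (R o\<^sub>L S)) x) = cinner (blinfun_apply (R o\<^sub>L S) w) x"
    by (simp only: cinner_adj[OF bounded_ops_comp[OF assms]])
  also have "\<dots> = cinner w (blinfun_apply (adj S) (blinfun_apply (adj R) x))"
    by (simp add: cinner_adj assms)
  finally show "cinner w (blinfun_apply (adj (R o\<^sub>L S)) x)
      = cinner w (blinfun_apply (adj S) (blinfun_apply (adj R) x))" .
qed

lemma adj_id_apply [simp]: "blinfun_apply (adj id_blinfun) x = x"
  by (rule cinner_eqI) (simp add: cinner_adj[symmetric] bounded_ops_def)

section \<open>Norms of weighted sums over words of fixed length\<close>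

section \<open>Row contractions\<close>

lemma word_op_Nil [simp]: "word_op T [] = id_blinfun"
  by (simp add: word_op_def)

lemma word_op_Cons: "word_op T (i # \<alpha>) = T i o\<^sub>L word_op T \<alpha>"
  by (simp add: word_op_def)

lemma word_op_bounded_op: "(\<And>i. T i \<in> \<B>) \<Longrightarrow> word_op T \<alpha> \<in> \<B>"
  by (induction \<alpha>) (simp_all add: word_op_Cons bounded_ops_comp, simp add: bounded_ops_def)

lemma finite_words [simp]: "finite {\<alpha> :: 'n::finite list. length \<alpha> = k}"
  using finite_lists_length_eq[of "UNIV :: 'n set" k] by simp

lemma words_0: "{\<alpha>. length \<alpha> = 0} = {[]}"
  by auto

text \<open>Splitting off the first letter is a bijection; it drives the inductions on word
  length.\<close>

lemma sum_words_Suc: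
  fixes f :: "'n::finite list \<Rightarrow> 'b::comm_monoid_add"
  shows "(\<Sum>\<alpha> | length \<alpha> = Suc k. f \<alpha>) = (\<Sum>i\<in>UNIV. \<Sum>\<alpha> | length \<alpha> = k. f (i # \<alpha>))"
proof -
  have "(\<Sum>\<alpha> | length \<alpha> = Suc k. f \<alpha>) = (\<Sum>(i, \<alpha>)\<in>UNIV \<times> {\<alpha>. length \<alpha> = k}. f (i # \<alpha>))"
    by (rule sum.reindex_bij_witness[where i = "\<lambda>(i, \<alpha>). i # \<alpha>" and j = "\<lambda>\<alpha>. (hd \<alpha>, tl \<alpha>)"])
      (auto simp: length_Suc_conv)
  also have "\<dots> = (\<Sum>i\<in>UNIV. \<Sum>\<alpha> | length \<alpha> = k. f (i # \<alpha>))"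
    by (rule sum.cartesian_product[symmetric])
  finally show ?thesis .
qed

text \<open>The row norm enters through the quadratic form of the sum of the
  \<open>T i o\<^sub>L adj (T i)\<close>, whose value at \<open>y\<close> is the sum of squared
  norms of the \<open>adj (T i) y\<close>.\<close>

lemma row_ballD:
  assumes "T \<in> row_ball r"
  shows "T i \<in> \<B>" and "0 \<le> r"
    and "(\<Sum>i\<in>UNIV. (norm (blinfun_apply (adj (T i)) y))\<^sup>2) \<le> r\<^sup>2 * (norm y)\<^sup>2"
proof -
  let ?S = "\<Sum>i\<in>UNIV. T i o\<^sub>L adj (T i)"
  have T: "\<And>i. T i \<in> \<B>" and r: "sqrt (norm ?S) \<le> r"
    using assms by (auto simp: row_ball_def)
  show "T i \<in> \<B>"
    by (rule T)
  show "0 \<le> r"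
    using r by (meson norm_ge_zero order_trans real_sqrt_ge_zero)
  have "(\<Sum>i\<in>UNIV. (norm (blinfun_apply (adj (T i)) y))\<^sup>2) = inner (blinfun_apply ?S y) y"
    by (simp add: blinfun.sum_left inner_sum_left inner_adj[OF T] power2_norm_eq_inner)
  also have "\<dots> \<le> norm (blinfun_apply ?S y) * norm y"
    by (rule norm_cauchy_schwarz)
  also have "\<dots> \<le> norm ?S * norm y * norm y"
    by (intro mult_right_mono norm_blinfun) simp
  also have "\<dots> \<le> r\<^sup>2 * norm y * norm y"
    using r by (intro mult_right_mono) (simp_all add: real_sqrt_le_iff sqrt_le_D)
  finally show "(\<Sum>i\<in>UNIV. (norm (blinfun_apply (adj (T i)) y))\<^sup>2) \<le> r\<^sup>2 * (norm y)\<^sup>2"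
    by (simp add: power2_eq_square mult.assoc)
qed

text \<open>The adjoint of the first letter acts first, so the induction hypothesis is applied to
  each vector \<open>adj (T i) y\<close>, and the row bound then sums over \<open>i\<close>.\<close>

lemma sum_norm_adj_word_op_le:
  assumes "T \<in> row_ball r"
  shows "(\<Sum>\<alpha> | length \<alpha> = k. (norm (blinfun_apply (adj (word_op T \<alpha>)) y))\<^sup>2) \<le> (r ^ k * norm y)\<^sup>2"
proof (induction k arbitrary: y)
  case 0
  then show ?case
    unfolding words_0 by simp
next
  case (Suc k)
  note T = row_ballD(1)[OF assms]
  have "(\<Sum>\<alpha> | length \<alpha> = Suc k. (norm (blinfun_apply (adj (word_op T \<alpha>)) y))\<^sup>2)
      = (\<Sum>i\<in>UNIV. \<Sum>\<alpha> | length \<alpha> = k.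
          (norm (blinfun_apply (adj (word_op T \<alpha>)) (blinfun_apply (adj (T i)) y)))\<^sup>2)"
    by (simp add: sum_words_Suc word_op_Cons adj_comp_apply T word_op_bounded_op)
  also have "\<dots> \<le> (\<Sum>i\<in>UNIV. (r ^ k * norm (blinfun_apply (adj (T i)) y))\<^sup>2)"
    by (intro sum_mono Suc.IH)
  also have "\<dots> = (r ^ k)\<^sup>2 * (\<Sum>i\<in>UNIV. (norm (blinfun_apply (adj (T i)) y))\<^sup>2)"
    by (simp add: power_mult_distrib sum_distrib_left)
  also have "\<dots> \<le> (r ^ k)\<^sup>2 * (r\<^sup>2 * (norm y)\<^sup>2)"
    by (intro mult_left_mono row_ballD[OF assms]) simp
  also have "\<dots> = (r ^ Suc k * norm y)\<^sup>2"
    by (simp add: power2_eq_square)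
  finally show ?case .
qed

text \<open>Cauchy-Schwarz over the words of length \<open>k\<close>; the common core of the two
  operator norm bounds that follow.\<close>

lemma sum_weighted_norm_adj_le:
  assumes "T \<in> row_ball r"
  shows "(\<Sum>\<alpha> | length \<alpha> = k. \<bar>c \<alpha>\<bar> * norm (blinfun_apply (adj (word_op T \<alpha>)) y))
    \<le> sqrt (\<Sum>\<alpha> | length \<alpha> = k. (c \<alpha>)\<^sup>2) * r ^ k * norm y"
proof -
  let ?n = "\<lambda>\<alpha>. norm (blinfun_apply (adj (word_op T \<alpha>)) y)"
  have "(\<Sum>\<alpha> | length \<alpha> = k. \<bar>c \<alpha>\<bar> * ?n \<alpha>)
      \<le> L2_set c {\<alpha>. length \<alpha> = k} * L2_set ?n {\<alpha>. length \<alpha> = k}"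
    using L2_set_mult_ineq[of c ?n] by simp
  also have "L2_set ?n {\<alpha>. length \<alpha> = k} \<le> sqrt ((r ^ k * norm y)\<^sup>2)"
    unfolding L2_set_def by (intro real_sqrt_le_mono sum_norm_adj_word_op_le assms)
  also have "\<dots> = r ^ k * norm y"
    using row_ballD(2)[OF assms] by simp
  finally show ?thesis
    by (simp add: L2_set_def mult_left_mono sum_nonneg mult.assoc)
qed

lemma norm_sum_adj_word_op_le:
  assumes "T \<in> row_ball r"
  shows "norm (\<Sum>\<alpha> | length \<alpha> = k. c \<alpha> *\<^sub>R adj (word_op T \<alpha>))
    \<le> sqrt (\<Sum>\<alpha> | length \<alpha> = k. (c \<alpha>)\<^sup>2) * r ^ k"
proof (rule norm_blinfun_bound)
  show "0 \<le> sqrt (\<Sum>\<alpha> | length \<alpha> = k. (c \<alpha>)\<^sup>2) * r ^ k"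
    using row_ballD(2)[OF assms] by (simp add: sum_nonneg)
  fix y
  have "norm (blinfun_apply (\<Sum>\<alpha> | length \<alpha> = k. c \<alpha> *\<^sub>R adj (word_op T \<alpha>)) y)
      \<le> (\<Sum>\<alpha> | length \<alpha> = k. \<bar>c \<alpha>\<bar> * norm (blinfun_apply (adj (word_op T \<alpha>)) y))"
    unfolding blinfun.sum_left by (rule sum_norm_le) (simp add: blinfun.scaleR_left)
  then show "norm (blinfun_apply (\<Sum>\<alpha> | length \<alpha> = k. c \<alpha> *\<^sub>R adj (word_op T \<alpha>)) y)
      \<le> sqrt (\<Sum>\<alpha> | length \<alpha> = k. (c \<alpha>)\<^sup>2) * r ^ k * norm y"
    using sum_weighted_norm_adj_le[OF assms] by (rule order_trans)
qed

text \<open>The row condition controls the adjoints only, so a triangle inequality for the vectors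
  \<open>word_op T \<alpha> x\<close> would lose too much. Pairing the image \<open>z\<close> of
  \<open>x\<close> with itself moves every word to the other side as an adjoint acting on
  \<open>z\<close>.\<close>

lemma norm_sum_word_op_le:
  assumes "T \<in> row_ball r"
  shows "norm (\<Sum>\<alpha> | length \<alpha> = k. c \<alpha> *\<^sub>R word_op T \<alpha>)
    \<le> sqrt (\<Sum>\<alpha> | length \<alpha> = k. (c \<alpha>)\<^sup>2) * r ^ k"
proof (rule norm_blinfun_bound)
  let ?C = "sqrt (\<Sum>\<alpha> | length \<alpha> = k. (c \<alpha>)\<^sup>2) * r ^ k"
  show "0 \<le> ?C"
    using row_ballD(2)[OF assms] by (simp add: sum_nonneg)
  fix x
  define z where "z = blinfun_apply (\<Sum>\<alpha> | length \<alpha> = k. c \<alpha> *\<^sub>R word_op T \<alpha>) x"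
  have "norm z * norm z = inner z z"
    by (simp add: power2_norm_eq_inner flip: power2_eq_square)
  also have "\<dots> = (\<Sum>\<alpha> | length \<alpha> = k. c \<alpha> * inner x (blinfun_apply (adj (word_op T \<alpha>)) z))"
    by (subst z_def)
      (simp add: blinfun.sum_left blinfun.scaleR_left inner_sum_left inner_adj
        word_op_bounded_op row_ballD(1)[OF assms])
  also have "\<dots> \<le> (\<Sum>\<alpha> | length \<alpha> = k. norm x * (\<bar>c \<alpha>\<bar> * norm (blinfun_apply (adj (word_op T \<alpha>)) z)))"
  proof (rule sum_mono)
    fix \<alpha>
    have "c \<alpha> * inner x (blinfun_apply (adj (word_op T \<alpha>)) z)
        \<le> \<bar>c \<alpha>\<bar> * \<bar>inner x (blinfun_apply (adj (word_op T \<alpha>)) z)\<bar>"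
      by (simp flip: abs_mult)
    also have "\<dots> \<le> \<bar>c \<alpha>\<bar> * (norm x * norm (blinfun_apply (adj (word_op T \<alpha>)) z))"
      by (intro mult_left_mono Cauchy_Schwarz_ineq2) simp
    finally show "c \<alpha> * inner x (blinfun_apply (adj (word_op T \<alpha>)) z)
        \<le> norm x * (\<bar>c \<alpha>\<bar> * norm (blinfun_apply (adj (word_op T \<alpha>)) z))"
      by (simp add: mult.left_commute)
  qed
  also have "\<dots> \<le> norm x * (?C * norm z)"
    unfolding sum_distrib_left[symmetric]
    by (intro mult_left_mono sum_weighted_norm_adj_le assms) simp
  finally have "norm z * norm z \<le> (?C * norm x) * norm z"
    by (simp add: ac_simps)
  then show "norm z \<le> ?C * norm x"
    using \<open>0 \<le> ?C\<close> by (cases "z = 0") (simp_all add: z_def[symmetric])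
qed

section \<open>Normal forms and quotients of positive words\<close>

section \<open>Reduced words in the free group\<close>

text \<open>Letters act on reduced words by left multiplication, opposite letters acting as inverse
  maps. This van der Waerden action gives uniqueness of normal forms without a confluence
  argument.\<close>

fun push :: "'n \<times> bool \<Rightarrow> ('n \<times> bool) list \<Rightarrow> ('n \<times> bool) list" where
  "push a [] = [a]"
| "push a (x # w) = (if x = (fst a, \<not> snd a) then w else a # x # w)"

fun reduced_word :: "('n \<times> bool) list \<Rightarrow> bool" where
  "reduced_word (a # x # w) \<longleftrightarrow> x \<noteq> (fst a, \<not> snd a) \<and> reduced_word (x # w)"
| "reduced_word _ \<longleftrightarrow> True"

definition reduce_word :: "('n \<times> bool) list \<Rightarrow> ('n \<times> bool) list"
  where "reduce_word w = foldr push w []"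

lemma reduced_push: "reduced_word w \<Longrightarrow> reduced_word (push a w)"
  by (induction w rule: reduced_word.induct) auto

text \<open>Reducedness matters when \<open>w\<close> starts with \<open>(i, b)\<close>: the inner
  push deletes that letter, and the outer one restores it because the next letter cannot be
  \<open>(i, \<not> b)\<close>.\<close>

lemma push_push_inverse: "reduced_word w \<Longrightarrow> push (i, b) (push (i, \<not> b) w) = w"
  by (cases w rule: reduced_word.cases) auto

lemma reduced_foldr_push: "reduced_word w \<Longrightarrow> reduced_word (foldr push u w)"
  by (induction u) (simp_all add: reduced_push)

lemma reduce_cancel_step: "cancel_step u v \<Longrightarrow> reduce_word u = reduce_word v"
  by (induction rule: cancel_step.induct)
    (simp add: reduce_word_def push_push_inverse reduced_foldr_push)

lemma reduce_eq_of_word_equiv: "word_equiv u v \<Longrightarrow> reduce_word u = reduce_word v"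
  by (induction rule: equivclp_induct) (auto dest: reduce_cancel_step)

lemma reduce_reduced: "reduced_word w \<Longrightarrow> reduce_word w = w"
  by (induction w rule: reduced_word.induct) (auto simp: reduce_word_def)

text \<open>\<open>reduce_word\<close> is constant on equivalence classes and fixes reduced words,
  so it separates the latter.\<close>

lemma word_equiv_reduced_imp_eq: "word_equiv u v \<Longrightarrow> reduced_word u \<Longrightarrow> reduced_word v \<Longrightarrow> u = v"
  by (metis reduce_eq_of_word_equiv reduce_reduced)

lemma reduced_map_pair: "reduced_word (map (\<lambda>i. (i, b)) \<alpha>)"
  by (induction \<alpha> rule: induct_list012) auto

lemma reduced_append:
  assumes "reduced_word (u @ [a])" "reduced_word (x # v)" "x \<noteq> (fst a, \<not> snd a)"
  shows "reduced_word (u @ a # x # v)"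
  using assms by (induction u rule: induct_list012) auto

lemma inv_word_map_pair: "inv_word (map (\<lambda>i. (i, b)) \<alpha>) = map (\<lambda>i. (i, \<not> b)) (rev \<alpha>)"
  by (simp add: inv_word_def rev_map)

lemma pos_eq_abs: "pos \<alpha> = abs_free_group (map (\<lambda>i. (i, True)) \<alpha>)"
  by (induction \<alpha>)
    (simp_all add: pos_def one_free_group.abs_eq gen.abs_eq times_free_group.abs_eq)

lemma abs_free_group_reduced_inject:
  "abs_free_group u = abs_free_group v \<Longrightarrow> reduced_word u \<Longrightarrow> reduced_word v \<Longrightarrow> u = v"
  by (auto simp: free_group.abs_eq_iff dest: word_equiv_reduced_imp_eq)

lemma inverse_pos_eq_abs:
  "inverse (pos \<alpha>) = abs_free_group (map (\<lambda>i. (i, False)) (rev \<alpha>))"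
  by (simp add: pos_eq_abs inverse_free_group.abs_eq inv_word_map_pair)

lemma pos_Nil [simp]: "pos [] = 1"
  by (simp add: pos_def)

lemma pos_append: "pos (\<alpha> @ \<beta>) = pos \<alpha> * pos \<beta>"
  by (simp add: pos_def)

lemma inj_pos: "inj pos"
proof (rule injI)
  fix \<alpha> \<beta> :: "'n list"
  assume "pos \<alpha> = pos \<beta>"
  then have "map (\<lambda>i. (i, True)) \<alpha> = map (\<lambda>i. (i, True)) \<beta>"
    unfolding pos_eq_abs by (rule abs_free_group_reduced_inject) (rule reduced_map_pair)+
  then show "\<alpha> = \<beta>"
    by (simp add: inj_map_eq_map inj_def)
qed

lemma free_group_inverse_unique:
  assumes "\<sigma> * \<tau> = (1 :: 'n free_group)"
  shows "inverse \<sigma> = \<tau>"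
  by (metis assms free_group_inverse_cancel mult.right_neutral)

lemma inverse_inverse_free_group [simp]: "inverse (inverse \<sigma>) = (\<sigma> :: 'n free_group)"
  by (rule free_group_inverse_unique) (rule free_group_left_inverse)

lemma inverse_mult_free_group: "inverse (\<sigma> * \<tau>) = inverse \<tau> * inverse (\<sigma> :: 'n free_group)"
  by (rule free_group_inverse_unique) (simp add: mult.assoc free_group_right_inverse)

text \<open>The letters \<open>i\<close> and \<open>j\<close> sit at the last disagreement.
  Induction from the front finds it, since the heads matter only when the tails agree.\<close>

lemma split_common_suffix:
  assumes "length \<alpha> = length \<beta>" "\<alpha> \<noteq> \<beta>"
  obtains \<alpha>' \<beta>' \<gamma> i j where "\<alpha> = \<alpha>' @ i # \<gamma>" "\<beta> = \<beta>' @ j # \<gamma>" "i \<noteq> j"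
proof -
  have "\<exists>\<alpha>' \<beta>' \<gamma> i j. \<alpha> = \<alpha>' @ i # \<gamma> \<and> \<beta> = \<beta>' @ j # \<gamma> \<and> i \<noteq> j"
    using assms
  proof (induction \<alpha> \<beta> rule: list_induct2)
    case (Cons x xs y ys)
    show ?case
    proof (cases "xs = ys")
      case True
      then show ?thesis
        using Cons.prems by (metis append_Nil)
    next
      case False
      then show ?thesis
        using Cons.IH by (metis append_Cons)
    qed
  qed simp
  then show ?thesis
    using that by blast
qed

text \<open>The common suffix cancels, and the last differing letters meet as
  \<open>(j, True)\<close>, \<open>(i, False)\<close> with \<open>i \<noteq> j\<close>, so nothing
  more cancels. The resulting reduced word has letters of both signs, whereas positive words and
  their inverses have only one.\<close>

lemma pos_mult_inverse_pos_notin: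
  assumes "length \<alpha> = length \<beta>" "\<alpha> \<noteq> \<beta>"
  shows "pos \<beta> * inverse (pos \<alpha>) \<notin> range pos \<union> inverse ` range pos"
proof -
  obtain \<alpha>' \<beta>' \<gamma> i j where split: "\<alpha> = \<alpha>' @ i # \<gamma>" "\<beta> = \<beta>' @ j # \<gamma>" "i \<noteq> j"
    using split_common_suffix[OF assms] .
  let ?P = "\<lambda>w. map (\<lambda>i. (i, True)) w" and ?M = "\<lambda>w. map (\<lambda>i. (i, False)) w"
  let ?w = "?P \<beta>' @ (j, True) # (i, False) # ?M (rev \<alpha>')"
  have "reduced_word ?w"
  proof (rule reduced_append)
    show "reduced_word (?P \<beta>' @ [(j, True)])"
      using reduced_map_pair[of True "\<beta>' @ [j]"] by simp
    show "reduced_word ((i, False) # ?M (rev \<alpha>'))"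
      using reduced_map_pair[of False "i # rev \<alpha>'"] by simp
  qed (use split in simp)
  have "pos \<beta> * inverse (pos \<alpha>) = pos (\<beta>' @ [j]) * inverse (pos (\<alpha>' @ [i]))"
    using pos_append[of "\<beta>' @ [j]" \<gamma>] pos_append[of "\<alpha>' @ [i]" \<gamma>]
    by (simp add: split mult.assoc inverse_mult_free_group)
  also have "\<dots> = abs_free_group ?w"
    by (simp add: pos_eq_abs[of "\<beta>' @ [j]"] inverse_pos_eq_abs
        times_free_group.abs_eq)
  finally have eq: "pos \<beta> * inverse (pos \<alpha>) = abs_free_group ?w" .
  show ?thesis
  proof
    assume "pos \<beta> * inverse (pos \<alpha>) \<in> range pos \<union> inverse ` range pos"
    then obtain \<delta> where "abs_free_group ?w = abs_free_group (?P \<delta>)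
        \<or> abs_free_group ?w = abs_free_group (?M (rev \<delta>))"
      unfolding eq by (auto simp: inverse_pos_eq_abs) (auto simp: pos_eq_abs)
    then have "?w = ?P \<delta> \<or> ?w = ?M (rev \<delta>)"
      using abs_free_group_reduced_inject[OF _ \<open>reduced_word ?w\<close> reduced_map_pair] by blast
    moreover have "(j, True) \<in> set ?w" "(i, False) \<in> set ?w"
      by auto
    ultimately have "(i, False) \<in> set (?P \<delta>) \<or> (j, True) \<in> set (?M (rev \<delta>))"
      by metis
    then show False
      by auto
  qed
qed

section \<open>The commutant of the right regular representation\<close>

section \<open>Right translations\<close>

lemma bij_mult_right: "bij (\<lambda>\<tau>. \<tau> * (\<sigma> :: 'n free_group))"
  by (rule bij_betw_byWitness[where f' = "\<lambda>\<tau>. \<tau> * inverse \<sigma>"])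
    (auto simp: mult.assoc free_group_left_inverse free_group_right_inverse)

text \<open>In this convention \<xi> \<rho> is sent to
  \<open>\<xi> (\<rho> * inverse \<sigma>)\<close>.\<close>

lift_definition right_translate :: "'n free_group \<Rightarrow> 'n free_group ell2 \<Rightarrow> 'n free_group ell2"
  is "\<lambda>\<sigma> f \<tau>. f (\<tau> * \<sigma>)"
  by (simp add: summable_on_reindex_bij_betw[OF bij_mult_right, of "\<lambda>i. (cmod (_ i))\<^sup>2"])

lemma right_translate_add: "right_translate \<sigma> (x + y) = right_translate \<sigma> x + right_translate \<sigma> y"
  and right_translate_scaleR: "right_translate \<sigma> (r *\<^sub>R x) = r *\<^sub>R right_translate \<sigma> x"
  and right_translate_scaleC: "right_translate \<sigma> (c *\<^sub>C x) = c *\<^sub>C right_translate \<sigma> x"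
  and right_translate_zero: "right_translate \<sigma> 0 = 0"
  by (transfer; simp)+

lemma norm_right_translate: "norm (right_translate \<sigma> x) = norm x"
proof -
  have "(norm (right_translate \<sigma> x))\<^sup>2 = (norm x)\<^sup>2"
    unfolding norm_ell2_square right_translate.rep_eq
    by (rule infsum_reindex_bij_betw[OF bij_mult_right])
  then show ?thesis
    by simp
qed

lemma bounded_linear_right_translate: "bounded_linear (right_translate \<sigma>)"
  by (rule bounded_linear_intro[where K = 1])
    (simp_all add: right_translate_add right_translate_scaleR norm_right_translate)

lemma cinner_right_translate:
  "cinner (right_translate \<sigma> x) y = cinner x (right_translate (inverse \<sigma>) y)"
proof -
  have "cinner x (right_translate (inverse \<sigma>) y)
      = (\<Sum>\<^sub>\<infinity>\<tau>. ell2_nth x (\<tau> * \<sigma>) * cnj (ell2_nth y (\<tau> * \<sigma> * inverse \<sigma>)))"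
    unfolding cinner_ell2_def right_translate.rep_eq
    by (rule infsum_reindex_bij_betw[OF bij_mult_right, symmetric])
  then show ?thesis
    by (simp add: cinner_ell2_def right_translate.rep_eq mult.assoc free_group_right_inverse)
qed

text \<open>The commutant of the right translations. It serves as a C*-algebra containing
  \<open>reduced_cstar\<close> whose elements have an explicit description.\<close>

definition right_invariant_ops :: "('n free_group ell2 \<Rightarrow>\<^sub>L 'n free_group ell2) set"
  where "right_invariant_ops = {S \<in> \<B>. \<forall>\<sigma> x.
    blinfun_apply S (right_translate \<sigma> x) = right_translate \<sigma> (blinfun_apply S x)}"

lemma right_invariant_opsD:
  assumes "S \<in> right_invariant_ops"
  shows "S \<in> \<B>"
    and "blinfun_apply S (right_translate \<sigma> x) = right_translate \<sigma> (blinfun_apply S x)"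
  using assms by (simp_all add: right_invariant_ops_def)

text \<open>The adjoint of a right translation is again a right translation, so its commutant is
  closed under adjoints.\<close>

lemma adj_right_invariant:
  assumes "S \<in> right_invariant_ops"
  shows "adj S \<in> right_invariant_ops"
  unfolding right_invariant_ops_def
proof (intro CollectI conjI allI)
  note S = right_invariant_opsD[OF assms]
  show "adj S \<in> \<B>"
    by (rule adj_bounded_op) (rule S)
  show "blinfun_apply (adj S) (right_translate \<sigma> x) = right_translate \<sigma> (blinfun_apply (adj S) x)" for \<sigma> x
  proof (rule cinner_eqI)
    fix y
    have right: "cinner w (right_translate \<sigma> v) = cinner (right_translate (inverse \<sigma>) w) v" for w v :: "'a free_group ell2"
      by (simp add: cinner_right_translate)
    show "cinner y (blinfun_apply (adj S) (right_translate \<sigma> x))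
        = cinner y (right_translate \<sigma> (blinfun_apply (adj S) x))"
      by (simp add: right S flip: cinner_adj)
  qed
qed

text \<open>All conditions are equations between functions of \<open>S\<close> that are
  norm-continuous, evaluation at a vector being bounded linear.\<close>

lemma closed_right_invariant_ops: "closed (right_invariant_ops :: ('n free_group ell2 \<Rightarrow>\<^sub>L _) set)"
proof -
  have app: "continuous_on UNIV (\<lambda>S :: 'n free_group ell2 \<Rightarrow>\<^sub>L 'n free_group ell2. blinfun_apply S x)" for x
    by (intro linear_continuous_on blinfun.bounded_linear_left)
  note comp = continuous_on_compose2[OF linear_continuous_on[where s = UNIV] app]
  show ?thesis
    unfolding right_invariant_ops_def bounded_ops_def mem_Collect_eq Collect_conj_eq
    by (intro closed_Int closed_Collect_all closed_Collect_eq app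
        comp[OF bounded_linear_scaleC] comp[OF bounded_linear_right_translate]) auto
qed

lemma cstar_subalgebra_right_invariant_ops: "cstar_subalgebra right_invariant_ops"
  unfolding cstar_subalgebra_def
proof (intro conjI ballI allI closed_right_invariant_ops adj_right_invariant)
  show "right_invariant_ops \<subseteq> \<B>"
    by (auto simp: right_invariant_ops_def)
qed (auto simp: right_invariant_ops_def bounded_ops_def blinfun.add_left scale_op_apply
    right_translate_add right_translate_scaleC right_translate_zero scaleC_add_right
    scaleC_scaleC mult.commute)

text \<open>Left and right translations commute by associativity; minimality of the hull does the
  rest.\<close>

lemma reduced_cstar_right_invariant: "reduced_cstar \<subseteq> right_invariant_ops"
  unfolding reduced_cstar_def
proof (rule hull_minimal)
  show "range U \<subseteq> right_invariant_ops"
    using U_bounded_op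
    by (auto simp: right_invariant_ops_def U.rep_eq translate.rep_eq right_translate.rep_eq
        mult.assoc intro: ell2_eqI)
qed (rule cstar_subalgebra_right_invariant_ops)

section \<open>Matrix coefficients and the bound on each homogeneous part\<close>

section \<open>Fourier coefficients\<close>

lemma cinner_basis_right: "cinner x (\<xi> \<sigma>) = ell2_nth x \<sigma>"
  unfolding cinner_ell2_def ell2_basis.rep_eq
  by (subst infsum_cong_neutral[where T = "{\<sigma>}" and g = "ell2_nth x"]) auto

lemma cinner_basis: "cinner (\<xi> \<sigma>) (\<xi> \<tau>) = (if \<tau> = \<sigma> then 1 else 0)"
  by (simp add: cinner_basis_right ell2_basis.rep_eq)

text \<open>The vector \<open>\<xi> \<sigma>\<close> is a right translate of \<open>\<xi> 1\<close>,
  and the translation can be pulled out of \<open>S\<close>. Hence the whole matrix of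
  \<open>S\<close> is determined by its column at the identity.\<close>

lemma cinner_basis_right_invariant:
  assumes "S \<in> right_invariant_ops"
  shows "cinner (blinfun_apply S (\<xi> \<sigma>)) (\<xi> \<tau>)
    = cinner (blinfun_apply S (\<xi> 1)) (\<xi> (\<tau> * inverse \<sigma>))"
proof -
  have "\<rho> * inverse \<sigma> = 1 \<longleftrightarrow> \<rho> = \<sigma>" for \<rho>
    by (metis free_group_left_inverse free_group_right_inverse mult.assoc mult.left_neutral mult.right_neutral)
  then have "\<xi> \<sigma> = right_translate (inverse \<sigma>) (\<xi> 1)"
    by (intro ell2_eqI) (simp add: right_translate.rep_eq ell2_basis.rep_eq)
  then show ?thesis
    by (simp add: right_invariant_opsD[OF assms] cinner_basis_right right_translate.rep_eq)
qed

lemma fourier_coefficient_bound: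
  fixes H :: "'n::finite free_group ell2 \<Rightarrow>\<^sub>L 'n free_group ell2"
  assumes H: "H \<in> reduced_cstar" "has_fourier_expansion H a" "adj H = H" "norm H \<le> 1"
    and k: "1 \<le> k"
  shows "cmod (a []) + sqrt (\<Sum>\<alpha> | length \<alpha> = k. (cmod (a \<alpha>))\<^sup>2) \<le> 1"
proof -
  let ?W = "{\<alpha> :: 'n list. length \<alpha> = k}"
  define A where "A = (\<Sum>\<alpha>\<in>?W. (cmod (a \<alpha>))\<^sup>2)"
  define u where "u = (\<Sum>\<alpha>\<in>?W. a \<alpha> *\<^sub>C \<xi> (pos \<alpha>))"
  have inv: "H \<in> right_invariant_ops"
    using H(1) reduced_cstar_right_invariant by blast
  note HB = right_invariant_opsD(1)[OF inv]
  have coeff_pos: "cinner (blinfun_apply H (\<xi> 1)) (\<xi> (pos \<alpha>)) = a \<alpha>"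
    and coeff_inv: "\<alpha> \<noteq> [] \<Longrightarrow> cinner (blinfun_apply H (\<xi> 1)) (\<xi> (inverse (pos \<alpha>))) = cnj (a \<alpha>)"
    and coeff_other: "\<sigma> \<notin> range pos \<union> inverse ` range pos \<Longrightarrow>
          cinner (blinfun_apply H (\<xi> 1)) (\<xi> \<sigma>) = 0"
    for \<alpha> \<sigma>
    using H(2) unfolding has_fourier_expansion_def by blast+
  have nonempty: "\<alpha> \<noteq> []" if "\<alpha> \<in> ?W" for \<alpha>
    using that k by auto
  have A_complex: "(\<Sum>\<alpha>\<in>?W. a \<alpha> * cnj (a \<alpha>)) = complex_of_real A"
    by (simp only: A_def of_real_sum complex_norm_square)
  have Hu: "blinfun_apply H u = (\<Sum>\<alpha>\<in>?W. a \<alpha> *\<^sub>C blinfun_apply H (\<xi> (pos \<alpha>)))"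
    by (simp add: u_def blinfun.sum_right bounded_opsD[OF HB])
  \<comment> \<open>The Fourier condition is Hermitian by itself for nonempty words only; reality of
    the constant term comes from \<open>adj H = H\<close>.\<close>
  have a0: "cnj (a []) = a []"
    using cinner_adj[OF HB, of "\<xi> 1" "\<xi> 1"] by (metis H(3) cinner_commute coeff_pos pos_Nil)
  have uu: "inner u u = A"
  proof -
    have "cinner u u = (\<Sum>\<alpha>\<in>?W. \<Sum>\<beta>\<in>?W. if \<alpha> = \<beta> then a \<alpha> * cnj (a \<beta>) else 0)"
      by (simp add: u_def cinner_sum_left cinner_sum_right cinner_scaleC_left cinner_scaleC_right
          cinner_basis inj_eq[OF inj_pos] if_distrib mult.commute sum.delta cong: if_cong)
    then show ?thesis
      by (simp add: inner_eq_Re_cinner A_complex)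
  qed
  have eu: "inner (\<xi> 1) u = 0"
  proof -
    have "pos \<alpha> \<noteq> 1" if "\<alpha> \<in> ?W" for \<alpha> :: "'n list"
      using nonempty[OF that] inj_eq[OF inj_pos, of \<alpha> "[]"] by simp
    then have "cinner (\<xi> 1) u = 0"
      by (simp add: u_def cinner_sum_right cinner_scaleC_right cinner_basis)
    then show ?thesis
      by (simp add: inner_eq_Re_cinner)
  qed
  have ee: "inner (\<xi> 1) (\<xi> 1 :: 'n free_group ell2) = 1"
    by (simp add: inner_eq_Re_cinner cinner_basis)
  have norm_sq: "(norm (s *\<^sub>R \<xi> 1 + t *\<^sub>R u))\<^sup>2 = s\<^sup>2 + t\<^sup>2 * A" for s t
    using eu inner_commute[of u "\<xi> 1"]
    by (simp add: power2_norm_eq_inner inner_simps uu ee) (simp add: power2_eq_square)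
  have Huu: "inner (blinfun_apply H u) u = Re (a []) * A"
  proof -
    \<comment> \<open>Off the diagonal the relevant group element is neither positive nor inverse to
      a positive one, so its Fourier coefficient vanishes.\<close>
    have "cinner (blinfun_apply H (\<xi> (pos \<alpha>))) (\<xi> (pos \<beta>)) = (if \<alpha> = \<beta> then a [] else 0)"
      if "\<alpha> \<in> ?W" "\<beta> \<in> ?W" for \<alpha> \<beta>
      using that coeff_pos[of "[]"] pos_mult_inverse_pos_notin[of \<alpha> \<beta>]
      by (subst cinner_basis_right_invariant[OF inv])
        (auto simp: free_group_right_inverse intro: coeff_other)
    then have "cinner (blinfun_apply H u) u
        = (\<Sum>\<alpha>\<in>?W. \<Sum>\<beta>\<in>?W. if \<alpha> = \<beta> then a [] * (a \<alpha> * cnj (a \<beta>)) else 0)"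
      unfolding Hu cinner_sum_left cinner_scaleC_left
      unfolding u_def cinner_sum_right cinner_scaleC_right sum_distrib_left
      by (intro sum.cong refl) simp
    also have "\<dots> = a [] * complex_of_real A"
      by (simp add: A_complex flip: sum_distrib_left)
    finally show ?thesis
      by (simp add: inner_eq_Re_cinner)
  qed
  have H1u: "inner (blinfun_apply H (\<xi> 1)) u = A"
  proof -
    have "cinner (blinfun_apply H (\<xi> 1)) u = complex_of_real A"
      by (simp add: u_def cinner_sum_right cinner_scaleC_right coeff_pos mult.commute
          flip: A_complex)
    then show ?thesis
      by (simp add: inner_eq_Re_cinner)
  qed
  have Hu1: "inner (blinfun_apply H u) (\<xi> 1) = A"
  proof -
    have "cinner (blinfun_apply H (\<xi> (pos \<alpha>))) (\<xi> 1) = cnj (a \<alpha>)" if "\<alpha> \<in> ?W" for \<alpha>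
      by (subst cinner_basis_right_invariant[OF inv]) (simp add: coeff_inv nonempty[OF that])
    then have "cinner (blinfun_apply H u) (\<xi> 1) = complex_of_real A"
      unfolding Hu A_complex[symmetric] by (simp add: cinner_sum_left cinner_scaleC_left)
    then show ?thesis
      by (simp add: inner_eq_Re_cinner)
  qed
  have H11: "inner (blinfun_apply H (\<xi> 1)) (\<xi> 1) = Re (a [])"
    using coeff_pos[of "[]"] by (simp add: inner_eq_Re_cinner)
  \<comment> \<open>The numerical range bound on the span of \<open>\<xi> 1\<close> and
    \<open>u\<close>; real \<open>s\<close> and \<open>t\<close> are enough because the compressed
    matrix is real.\<close>
  have form: "\<bar>(s\<^sup>2 + t\<^sup>2 * A) * Re (a []) + 2 * s * t * A\<bar> \<le> s\<^sup>2 + t\<^sup>2 * A" for s t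
  proof -
    let ?v = "s *\<^sub>R \<xi> 1 + t *\<^sub>R u"
    have "\<bar>inner (blinfun_apply H ?v) ?v\<bar> \<le> norm (blinfun_apply H ?v) * norm ?v"
      by (rule Cauchy_Schwarz_ineq2)
    also have "\<dots> \<le> (norm H * norm ?v) * norm ?v"
      by (intro mult_right_mono norm_blinfun) simp
    also have "\<dots> \<le> (1 * norm ?v) * norm ?v"
      by (intro mult_right_mono H) simp_all
    also have "\<dots> = s\<^sup>2 + t\<^sup>2 * A"
      by (simp add: norm_sq flip: power2_eq_square)
    also have "inner (blinfun_apply H ?v) ?v = (s\<^sup>2 + t\<^sup>2 * A) * Re (a []) + 2 * s * t * A"
      by (simp add: blinfun.add_right blinfun.scaleR_right inner_simps H11 H1u Hu1 Huu
          power2_eq_square algebra_simps)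
    finally show ?thesis .
  qed
  have "A \<ge> 0"
    by (simp add: A_def sum_nonneg)
  have cmod_a0: "cmod (a []) = \<bar>Re (a [])\<bar>"
    using a0 by (simp add: complex_eq_iff cmod_def)
  have "\<bar>Re (a [])\<bar> + sqrt A \<le> 1"
  proof (cases "A = 0")
    case True
    then show ?thesis
      using form[of 1 0] by simp
  next
    case False
    define q where "q = sqrt A"
    have q: "q > 0" "A = q * q"
      using False \<open>A \<ge> 0\<close> by (simp_all add: q_def)
    \<comment> \<open>The vectors \<open>q *\<^sub>R \<xi> 1 + \<epsilon> *\<^sub>R u\<close> are
      the eigenvectors of the compression, with squared norm \<open>2 * A\<close> and eigenvalues
      \<open>Re (a []) + \<epsilon> * q\<close>.\<close>
    have "\<bar>2 * A * (Re (a []) + \<epsilon> * q)\<bar> \<le> 2 * A" if "\<epsilon> = 1 \<or> \<epsilon> = -1" for \<epsilon>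
      using form[of q \<epsilon>] that q by (auto simp: power2_eq_square algebra_simps)
    from this[of 1] this[of "-1"] have "\<bar>Re (a []) + q\<bar> \<le> 1" "\<bar>Re (a []) - q\<bar> \<le> 1"
      using q by (simp_all add: abs_mult)
    then show ?thesis
      unfolding q_def by linarith
  qed
  then show ?thesis
    by (simp add: cmod_a0 A_def)
qed

section \<open>Geometric series and the Bohr radii\<close>

section \<open>Bohr inequalities\<close>

lemma summable_suminf_le_geometric:
  fixes f :: "nat \<Rightarrow> real"
  assumes "\<And>k. 0 \<le> f k" "\<And>k. f k \<le> c * r ^ Suc k" "0 \<le> r" "r < 1"
  shows "summable f \<and> suminf f \<le> c * r / (1 - r)"
proof -
  have "(\<lambda>k. (c * r) * r ^ k) sums ((c * r) * (1 / (1 - r)))"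
    using assms by (intro sums_mult geometric_sums) simp
  then have sums: "(\<lambda>k. c * r ^ Suc k) sums (c * r / (1 - r))"
    by (simp add: mult.assoc)
  have "summable f"
    by (rule summable_comparison_test[OF _ sums_summable[OF sums]]) (use assms in auto)
  then show ?thesis
    using suminf_le[OF assms(2) _ sums_summable[OF sums]] sums_unique[OF sums] by simp
qed

text \<open>At radius 1/2 the geometric tail \<open>r / (1 - r)\<close> equals 1, so the terms from
  index 1 on contribute at most \<open>1 - b\<close>, which the zeroth term completes to 1.\<close>

lemma suminf_bohr_half:
  fixes f :: "nat \<Rightarrow> real"
  assumes "f 0 \<le> b" "\<And>k. 0 \<le> f (Suc k)" "\<And>k. f (Suc k) \<le> (1 - b) * (1/2) ^ Suc k"
  shows "summable f \<and> suminf f \<le> 1"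
proof -
  have "summable (\<lambda>k. f (Suc k)) \<and> (\<Sum>k. f (Suc k)) \<le> (1 - b) * (1/2) / (1 - 1/2)"
    using assms(2,3) by (intro summable_suminf_le_geometric) auto
  then show ?thesis
    using assms(1) by (auto simp: summable_Suc_iff suminf_split_head)
qed

text \<open>At radius 1/3 the tail \<open>r / (1 - r)\<close> equals 1/2, so two such series fit
  into \<open>1 - b\<close>.\<close>

lemma suminf_bohr_third:
  fixes f :: "nat \<Rightarrow> real"
  assumes "\<And>k. 0 \<le> f k" "\<And>k. f k \<le> (1 - b) * (1/3) ^ Suc k"
  shows "summable f \<and> 2 * suminf f \<le> 1 - b"
  using summable_suminf_le_geometric[OF assms(1) assms(2)] by simp

text \<open>Expanding the \<open>k\<close>-th power of the sum of the squares of the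
  \<open>r $ i\<close> without collecting commuting factors gives one term per word.\<close>

lemma sum_words_power2:
  fixes r :: "real ^ 'n::finite"
  shows "(\<Sum>\<alpha> | length \<alpha> = k. (prod_list (map (($) r) \<alpha>))\<^sup>2) = ((norm r)\<^sup>2) ^ k"
proof (induction k)
  case 0
  then show ?case
    unfolding words_0 by simp
next
  case (Suc k)
  have "(norm r)\<^sup>2 = (\<Sum>i\<in>UNIV. (r $ i)\<^sup>2)"
    by (simp add: norm_vec_def L2_set_def sum_nonneg)
  then show ?case
    by (simp add: sum_words_Suc power_mult_distrib Suc.IH flip: sum_distrib_left sum_distrib_right)
qed

text \<open>Cauchy-Schwarz directly on scalars, without passing through operators on a
  one-dimensional space.\<close>

lemma sum_words_weighted_le:
  fixes r :: "real ^ 'n::finite"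
  assumes "norm r \<le> q"
  shows "(\<Sum>\<alpha> | length \<alpha> = k. cmod (a \<alpha>) * prod_list (map (($) r) \<alpha>))
    \<le> sqrt (\<Sum>\<alpha> | length \<alpha> = k. (cmod (a \<alpha>))\<^sup>2) * q ^ k"
proof -
  let ?p = "\<lambda>\<alpha>. prod_list (map (($) r) \<alpha>)" and ?W = "{\<alpha> :: 'n list. length \<alpha> = k}"
  have "(\<Sum>\<alpha>\<in>?W. cmod (a \<alpha>) * ?p \<alpha>) \<le> (\<Sum>\<alpha>\<in>?W. \<bar>cmod (a \<alpha>)\<bar> * \<bar>?p \<alpha>\<bar>)"
    by (intro sum_mono) (simp add: mult_left_mono)
  also have "\<dots> \<le> L2_set (\<lambda>\<alpha>. cmod (a \<alpha>)) ?W * L2_set ?p ?W"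
    by (rule L2_set_mult_ineq)
  also have "L2_set ?p ?W = norm r ^ k"
    by (simp add: L2_set_def sum_words_power2 real_sqrt_power)
  also have "L2_set (\<lambda>\<alpha>. cmod (a \<alpha>)) ?W * norm r ^ k \<le> L2_set (\<lambda>\<alpha>. cmod (a \<alpha>)) ?W * q ^ k"
    by (intro mult_left_mono power_mono assms) auto
  finally show ?thesis
    by (simp add: L2_set_def)
qed

text \<open>Summability is asserted along with each bound, because \<open>suminf\<close> of a
  divergent series is an unspecified number.\<close>

theorem corollary1p11:
  fixes H :: "'n::finite free_group ell2 \<Rightarrow>\<^sub>L 'n free_group ell2"
    and a :: "'n list \<Rightarrow> complex"
  assumes "H \<in> reduced_cstar"
    and "has_fourier_expansion H a"
    and "adj H = H"
    and "norm H \<le> 1"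
  shows
    "(\<forall>k\<ge>1. sqrt (\<Sum>\<alpha> | length \<alpha> = k. (cmod (a \<alpha>))\<^sup>2) \<le> 1 - cmod (a [])) \<and>
     (\<forall>T :: 'n \<Rightarrow> ('h::complex_hilbert \<Rightarrow>\<^sub>L 'h). T \<in> row_ball (1/2) \<longrightarrow>
        summable (\<lambda>k. norm (\<Sum>\<alpha> | length \<alpha> = k. cmod (a \<alpha>) *\<^sub>R word_op T \<alpha>)) \<and>
        (\<Sum>k. norm (\<Sum>\<alpha> | length \<alpha> = k. cmod (a \<alpha>) *\<^sub>R word_op T \<alpha>)) \<le> 1) \<and>
     (\<forall>T :: 'n \<Rightarrow> ('h \<Rightarrow>\<^sub>L 'h). T \<in> row_ball (1/3) \<longrightarrow>
        summable (\<lambda>k. norm (\<Sum>\<alpha> | length \<alpha> = Suc k. cmod (cnj (a \<alpha>)) *\<^sub>R adj (word_op T \<alpha>))) \<and>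
        summable (\<lambda>k. norm (\<Sum>\<alpha> | length \<alpha> = Suc k. cmod (a \<alpha>) *\<^sub>R word_op T \<alpha>)) \<and>
        (\<Sum>k. norm (\<Sum>\<alpha> | length \<alpha> = Suc k. cmod (cnj (a \<alpha>)) *\<^sub>R adj (word_op T \<alpha>)))
          + cmod (a [])
          + (\<Sum>k. norm (\<Sum>\<alpha> | length \<alpha> = Suc k. cmod (a \<alpha>) *\<^sub>R word_op T \<alpha>)) \<le> 1) \<and>
     (\<forall>r :: real ^ 'n. (\<forall>i. r $ i \<ge> 0) \<and> norm r \<le> 1/2 \<longrightarrow>
        summable (\<lambda>k. \<Sum>\<alpha> | length \<alpha> = k. cmod (a \<alpha>) * prod_list (map (($) r) \<alpha>)) \<and>
        (\<Sum>k. \<Sum>\<alpha> | length \<alpha> = k. cmod (a \<alpha>) * prod_list (map (($) r) \<alpha>)) \<le> 1) \<and>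
     (\<forall>r :: real ^ 'n. (\<forall>i. r $ i \<ge> 0) \<and> norm r \<le> 1/3 \<longrightarrow>
        summable (\<lambda>k. \<Sum>\<alpha> | length \<alpha> = Suc k. cmod (a \<alpha>) * prod_list (map (($) r) \<alpha>)) \<and>
        cmod (a []) + 2 * (\<Sum>k. \<Sum>\<alpha> | length \<alpha> = Suc k. cmod (a \<alpha>) * prod_list (map (($) r) \<alpha>)) \<le> 1)"
proof -
  let ?A = "\<lambda>k. sqrt (\<Sum>\<alpha> | length \<alpha> = k. (cmod (a \<alpha>))\<^sup>2)"
  define b where "b = cmod (a [])"
  have bound: "?A k \<le> 1 - b" if "1 \<le> k" for k
    using fourier_coefficient_bound[OF assms that] by (simp add: b_def)
  \<comment> \<open>Puts the operator and scalar estimates alike into the form required by the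
    geometric series lemmas.\<close>
  have bound_Suc: "x \<le> (1 - b) * q ^ Suc k" if "x \<le> ?A (Suc k) * q ^ Suc k" "0 \<le> q" for x q k
    using that(1) mult_right_mono[OF bound[of "Suc k"], of "q ^ Suc k"] that(2) by simp
  have prod_nonneg: "0 \<le> prod_list (map (($) r) \<alpha>)" if "\<forall>i. 0 \<le> r $ i" for r :: "real ^ 'n" and \<alpha>
    using that by (induction \<alpha>) simp_all

  have bohr_half: "summable (\<lambda>k. norm (\<Sum>\<alpha> | length \<alpha> = k. cmod (a \<alpha>) *\<^sub>R word_op T \<alpha>)) \<and>
      (\<Sum>k. norm (\<Sum>\<alpha> | length \<alpha> = k. cmod (a \<alpha>) *\<^sub>R word_op T \<alpha>)) \<le> 1"
    if T: "T \<in> row_ball (1/2)" for T :: "'n \<Rightarrow> ('h \<Rightarrow>\<^sub>L 'h)"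
  proof (rule suminf_bohr_half[of _ b])
    \<comment> \<open>Only the empty word contributes. An inequality is the right claim, as the
      identity has norm 0 on the zero space.\<close>
    show "norm (\<Sum>\<alpha> | length \<alpha> = 0. cmod (a \<alpha>) *\<^sub>R word_op T \<alpha>) \<le> b"
      using norm_sum_word_op_le[OF T, where k = 0 and c = "\<lambda>\<alpha>. cmod (a \<alpha>)"]
      unfolding words_0 by (simp add: b_def)
    show "norm (\<Sum>\<alpha> | length \<alpha> = Suc k. cmod (a \<alpha>) *\<^sub>R word_op T \<alpha>)
        \<le> (1 - b) * (1/2) ^ Suc k" for k
      by (intro bound_Suc norm_sum_word_op_le T) simp
  qed simp

  have bohr_third: "summable (\<lambda>k. norm (\<Sum>\<alpha> | length \<alpha> = Suc k. cmod (cnj (a \<alpha>)) *\<^sub>R adj (word_op T \<alpha>))) \<and>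
      summable (\<lambda>k. norm (\<Sum>\<alpha> | length \<alpha> = Suc k. cmod (a \<alpha>) *\<^sub>R word_op T \<alpha>)) \<and>
      (\<Sum>k. norm (\<Sum>\<alpha> | length \<alpha> = Suc k. cmod (cnj (a \<alpha>)) *\<^sub>R adj (word_op T \<alpha>)))
        + cmod (a [])
        + (\<Sum>k. norm (\<Sum>\<alpha> | length \<alpha> = Suc k. cmod (a \<alpha>) *\<^sub>R word_op T \<alpha>)) \<le> 1"
    if T: "T \<in> row_ball (1/3)" for T :: "'n \<Rightarrow> ('h \<Rightarrow>\<^sub>L 'h)"
  proof -
    let ?f = "\<lambda>k. norm (\<Sum>\<alpha> | length \<alpha> = Suc k. cmod (a \<alpha>) *\<^sub>R word_op T \<alpha>)"
    let ?g = "\<lambda>k. norm (\<Sum>\<alpha> | length \<alpha> = Suc k. cmod (cnj (a \<alpha>)) *\<^sub>R adj (word_op T \<alpha>))"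
    have "summable ?f \<and> 2 * suminf ?f \<le> 1 - b"
      by (intro suminf_bohr_third bound_Suc norm_sum_word_op_le T) auto
    \<comment> \<open>Conjugation leaves the moduli unchanged, so the adjoint series obeys the same
      bound and takes the other half of \<open>1 - b\<close>.\<close>
    moreover have "summable ?g \<and> 2 * suminf ?g \<le> 1 - b"
      unfolding complex_mod_cnj by (intro suminf_bohr_third bound_Suc norm_sum_adj_word_op_le T) auto
    ultimately have "summable ?g" "summable ?f" "suminf ?g + cmod (a []) + suminf ?f \<le> 1"
      unfolding b_def by linarith+
    then show ?thesis
      by blast
  qed

  have scalar_half: "summable (\<lambda>k. \<Sum>\<alpha> | length \<alpha> = k. cmod (a \<alpha>) * prod_list (map (($) r) \<alpha>)) \<and>
      (\<Sum>k. \<Sum>\<alpha> | length \<alpha> = k. cmod (a \<alpha>) * prod_list (map (($) r) \<alpha>)) \<le> 1"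
    if "(\<forall>i. r $ i \<ge> 0) \<and> norm r \<le> 1/2" for r :: "real ^ 'n"
  proof (rule suminf_bohr_half[of _ b])
    show "(\<Sum>\<alpha> | length \<alpha> = 0. cmod (a \<alpha>) * prod_list (map (($) r) \<alpha>)) \<le> b"
      unfolding words_0 by (simp add: b_def)
    show "0 \<le> (\<Sum>\<alpha> | length \<alpha> = Suc k. cmod (a \<alpha>) * prod_list (map (($) r) \<alpha>))" for k
      using that prod_nonneg[of r] by (intro sum_nonneg) simp
    show "(\<Sum>\<alpha> | length \<alpha> = Suc k. cmod (a \<alpha>) * prod_list (map (($) r) \<alpha>))
        \<le> (1 - b) * (1/2) ^ Suc k" for k
      using that by (intro bound_Suc sum_words_weighted_le) auto
  qed

  have scalar_third: "summable (\<lambda>k. \<Sum>\<alpha> | length \<alpha> = Suc k. cmod (a \<alpha>) * prod_list (map (($) r) \<alpha>)) \<and>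
      cmod (a []) + 2 * (\<Sum>k. \<Sum>\<alpha> | length \<alpha> = Suc k. cmod (a \<alpha>) * prod_list (map (($) r) \<alpha>)) \<le> 1"
    if "(\<forall>i. r $ i \<ge> 0) \<and> norm r \<le> 1/3" for r :: "real ^ 'n"
  proof -
    let ?f = "\<lambda>k. \<Sum>\<alpha> | length \<alpha> = Suc k. cmod (a \<alpha>) * prod_list (map (($) r) \<alpha>)"
    have "summable ?f \<and> 2 * suminf ?f \<le> 1 - b"
      using that prod_nonneg[of r]
      by (intro suminf_bohr_third bound_Suc sum_words_weighted_le sum_nonneg) auto
    then show ?thesis
      by (auto simp: b_def)
  qed

  show ?thesis
    using bound bohr_half bohr_third scalar_half scalar_third unfolding b_def by blast
qed

end
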